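(* Let $X$ and $Y$ be Tychonoff spaces such that $C_p(X,\mathbb{T})$ and $C_p(Y,\mathbb{T})$ are topologically isomorphic. Then: (i) $X$ is pseudocompact iff $Y$ is; (ii) $l^*(X)=l^*(Y)$; (iii) $X$ is a Lindel\"of $\Sigma$-space iff $Y$ is; (iv) $X$ is $\sigma$-compact iff $Y$ is; (v) $X$ is compact iff $Y$ is; (vi) $X$ is compact metrizable iff $Y$ is; (vii) $X$ has exactly $n$ connected components (for a given positive integer $n$) iff $Y$ does; (viii) $X$ is connected iff $Y$ is; (ix) $X$ is totally disconnected iff $Y$ is.
   Context: $\mathbb{T}=\mathbb{R}/\mathbb{Z}$; $C_p(X,\mathbb{T})$ is the group of continuous maps $X\to\mathbb{T}$ with pointwise operations and topology of pointwise convergence. $l(\cdot)$ is the Lindel\"of number and $l^*(X)=\sup\{l(X^n):n\in\mathbb{N}\}$. A space is totally disconnected if any two distinct points are separated by a clopen set. *)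

theory Defs
  imports "HOL-Analysis.Analysis"
begin

definition tychonoff_space :: "'a topology \<Rightarrow> bool" where
  "tychonoff_space X \<longleftrightarrow> completely_regular_space X \<and> Hausdorff_space X"

text \<open>The circle group T = R/Z, realised (isomorphically as a topological group)
  as the unit circle in the complex plane with multiplication.\<close>
definition circle_top :: "complex topology" where
  "circle_top = top_of_set (sphere 0 1)"

definition Cp_carrier :: "'a topology \<Rightarrow> ('a \<Rightarrow> complex) set" where
  "Cp_carrier X = {f. continuous_map X circle_top f \<and> f \<in> extensional (topspace X)}"

definition Cp_mult :: "'a topology \<Rightarrow> ('a \<Rightarrow> complex) \<Rightarrow> ('a \<Rightarrow> complex) \<Rightarrow> ('a \<Rightarrow> complex)" where
  "Cp_mult X f g = restrict (\<lambda>x. f x * g x) (topspace X)"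

definition Cp_top :: "'a topology \<Rightarrow> ('a \<Rightarrow> complex) topology" where
  "Cp_top X = subtopology (product_topology (\<lambda>_. circle_top) (topspace X)) (Cp_carrier X)"

definition Cp_top_isomorphic :: "'a topology \<Rightarrow> 'b topology \<Rightarrow> bool" where
  "Cp_top_isomorphic X Y \<longleftrightarrow>
     (\<exists>\<phi>. bij_betw \<phi> (Cp_carrier X) (Cp_carrier Y)
          \<and> (\<forall>f\<in>Cp_carrier X. \<forall>g\<in>Cp_carrier X. \<phi> (Cp_mult X f g) = Cp_mult Y (\<phi> f) (\<phi> g))
          \<and> homeomorphic_map (Cp_top X) (Cp_top Y) \<phi>)"

definition pseudocompact :: "'a topology \<Rightarrow> bool" where
  "pseudocompact X \<longleftrightarrow>
     (\<forall>f. continuous_map X euclideanreal f \<longrightarrow> bounded (f ` topspace X))"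

definition lindelof_number_le :: "'a topology \<Rightarrow> 'c set \<Rightarrow> bool" where
  "lindelof_number_le X K \<longleftrightarrow>
     (\<forall>\<U>. (\<forall>U\<in>\<U>. openin X U) \<and> topspace X \<subseteq> \<Union>\<U> \<longrightarrow>
        (\<exists>\<V>\<subseteq>\<U>. topspace X \<subseteq> \<Union>\<V> \<and> \<V> \<lesssim> K))"

definition lstar_le :: "'a topology \<Rightarrow> 'c set \<Rightarrow> bool" where
  "lstar_le X K \<longleftrightarrow> (\<forall>n::nat. lindelof_number_le (product_topology (\<lambda>_. X) {..<n}) K)"

definition lindelof_sigma_space :: "'a topology \<Rightarrow> bool" where
  "lindelof_sigma_space X \<longleftrightarrow>
     (\<exists>\<N> \<C>. countable \<N> \<and> (\<forall>C\<in>\<C>. compactin X C) \<and> \<Union>\<C> = topspace X \<and>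
        (\<forall>C\<in>\<C>. \<forall>U. openin X U \<and> C \<subseteq> U \<longrightarrow> (\<exists>N\<in>\<N>. C \<subseteq> N \<and> N \<subseteq> U)))"

definition sigma_compact_space :: "'a topology \<Rightarrow> bool" where
  "sigma_compact_space X \<longleftrightarrow>
     (\<exists>\<C>. countable \<C> \<and> (\<forall>C\<in>\<C>. compactin X C) \<and> \<Union>\<C> = topspace X)"

definition totally_disconnected_space :: "'a topology \<Rightarrow> bool" where
  "totally_disconnected_space X \<longleftrightarrow>
     (\<forall>x\<in>topspace X. \<forall>y\<in>topspace X. x \<noteq> y \<longrightarrow>
        (\<exists>U. openin X U \<and> closedin X U \<and> x \<in> U \<and> y \<notin> U))"

end

theory Submission
  imports Defs
begin

text \<open>
  Evaluating an isomorphism \<open>\<phi>\<close> from \<open>C\<^sub>p(X,T)\<close> to \<open>C\<^sub>p(Y,T)\<close> at a point \<open>y\<close> gives a continuous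
  character of \<open>C\<^sub>p(X,T)\<close>. Since \<open>T\<close> has no small subgroups, this character depends on the values
  at finitely many points only, so that \<open>\<phi> f y = (\<Prod>x\<in>S. f x powi k x)\<close> for a finite \<open>S\<close> and
  integers \<open>k x\<close>; the same holds for the inverse of \<open>\<phi>\<close>. All invariants are extracted from these
  two families of formulas.

  A product of evaluations at points of \<open>Y\<close> is itself an evaluation iff its value at each \<open>g\<close> lies in
  the closure of the range of \<open>g\<close>, which is a closed condition. Hence every finite power of \<open>Y\<close> is a countable
  union of continuous images of closed subspaces of finite powers of \<open>X\<close>; this yields (ii)-(iv).
  Pseudocompactness of \<open>X\<close> is equivalent to the absence of nontrivial maps \<open>f n\<close> all of whose
  products with integer exponents converge (in finitely many steps at each point) in
  \<open>C\<^sub>p(X,T)\<close>, and compactness is \<open>\<sigma>\<close>-compactness plus pseudocompactness. The clopen sets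
  of \<open>X\<close> correspond to the solutions of \<open>f\<^sup>2 = 1\<close>; metrizability and total disconnectedness
  transfer by separating points of \<open>Y\<close> with images of suitable maps on \<open>X\<close> that have a
  nontrivial value at exactly one point of a given finite set.
\<close>

section \<open>Continuous maps into the circle and exponentials of real functions\<close>

definition cis_map :: "'a topology \<Rightarrow> ('a \<Rightarrow> real) \<Rightarrow> 'a \<Rightarrow> complex" where
  "cis_map X h = restrict (\<lambda>x. cis (h x)) (topspace X)"

lemma continuous_map_circle_iff:
  "continuous_map X circle_top f \<longleftrightarrow>
     continuous_map X euclidean f \<and> (\<forall>x\<in>topspace X. norm (f x) = 1)"
  by (auto simp: circle_top_def continuous_map_in_subtopology)

lemma Cp_carrier_iff:
  "f \<in> Cp_carrier X \<longleftrightarrow>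
     continuous_map X euclidean f \<and> (\<forall>x\<in>topspace X. norm (f x) = 1) \<and> f \<in> extensional (topspace X)"
  by (auto simp: Cp_carrier_def continuous_map_circle_iff)

lemma Cp_carrier_norm: "f \<in> Cp_carrier X \<Longrightarrow> x \<in> topspace X \<Longrightarrow> norm (f x) = 1"
  by (simp add: Cp_carrier_iff)

lemma Cp_carrier_nonzero: "f \<in> Cp_carrier X \<Longrightarrow> x \<in> topspace X \<Longrightarrow> f x \<noteq> 0"
  using Cp_carrier_norm by fastforce

lemma Cp_carrier_restrict:
  assumes "continuous_map X euclidean f" "\<And>x. x \<in> topspace X \<Longrightarrow> norm (f x) = 1"
  shows "restrict f (topspace X) \<in> Cp_carrier X"
  using assms by (auto simp: Cp_carrier_iff intro: continuous_map_eq)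

lemma Cp_carrier_eqI:
  assumes "f \<in> Cp_carrier X" "g \<in> Cp_carrier X" "\<And>x. x \<in> topspace X \<Longrightarrow> f x = g x"
  shows "f = g"
  using assms by (auto simp: Cp_carrier_iff intro: extensionalityI)

lemma continuous_map_mult_complex:
  fixes f g :: "'a \<Rightarrow> complex"
  assumes "continuous_map X euclidean f" "continuous_map X euclidean g"
  shows "continuous_map X euclidean (\<lambda>x. f x * g x)"
  using assms by (auto simp: continuous_map_atin tendsto_mult)

lemma continuous_map_powi_complex:
  fixes f :: "'a \<Rightarrow> complex"
  assumes "continuous_map X euclidean f" "\<And>x. x \<in> topspace X \<Longrightarrow> f x \<noteq> 0"
  shows "continuous_map X euclidean (\<lambda>x. f x powi n)"
  using assms by (auto simp: continuous_map_atin tendsto_power_int)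

lemma continuous_map_prod_complex:
  fixes f :: "'i \<Rightarrow> 'a \<Rightarrow> complex"
  assumes "\<And>i. i \<in> I \<Longrightarrow> continuous_map X euclidean (f i)"
  shows "continuous_map X euclidean (\<lambda>x. \<Prod>i\<in>I. f i x)"
  using assms
  by (induction I rule: infinite_finite_induct) (auto intro: continuous_map_mult_complex)

lemma continuous_map_cis:
  assumes "continuous_map X euclideanreal h"
  shows "continuous_map X euclidean (\<lambda>x. cis (h x))"
proof -
  have "continuous_map euclideanreal euclidean cis"
    by (simp add: continuous_on_cis)
  then have "continuous_map X euclidean (cis \<circ> h)"
    using assms continuous_map_compose by blast
  then show ?thesis by (simp add: o_def)
qed

lemma cis_map_in_Cp:
  "continuous_map X euclideanreal h \<Longrightarrow> cis_map X h \<in> Cp_carrier X"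
  unfolding cis_map_def by (rule Cp_carrier_restrict) (auto simp: continuous_map_cis)

lemma cis_map_apply [simp]: "x \<in> topspace X \<Longrightarrow> cis_map X h x = cis (h x)"
  by (simp add: cis_map_def)

lemma Cp_mult_apply [simp]: "x \<in> topspace X \<Longrightarrow> Cp_mult X f g x = f x * g x"
  by (simp add: Cp_mult_def)

lemma Cp_mult_in_Cp:
  "f \<in> Cp_carrier X \<Longrightarrow> g \<in> Cp_carrier X \<Longrightarrow> Cp_mult X f g \<in> Cp_carrier X"
  unfolding Cp_mult_def
  by (rule Cp_carrier_restrict) (auto simp: Cp_carrier_iff norm_mult intro: continuous_map_mult_complex)

lemma Cp_mult_cis_map: "Cp_mult X (cis_map X g) (cis_map X h) = cis_map X (\<lambda>x. g x + h x)"
  by (auto simp: Cp_mult_def cis_map_def cis_mult)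

lemma topspace_Cp_top [simp]: "topspace (Cp_top X) = Cp_carrier X"
proof -
  have "Cp_carrier X \<subseteq> topspace (product_topology (\<lambda>_. circle_top) (topspace X))"
    by (auto simp: Cp_carrier_def PiE_def circle_top_def continuous_map_def Pi_def)
  then show ?thesis
    by (auto simp: Cp_top_def)
qed

subsection \<open>No small subgroups\<close>

text \<open>If all powers of \<open>a\<close> stayed within distance 1 of 1, their real parts would
  exceed 1/2. Then |b^2 - 1| = |b + 1| |b - 1| is at least 3/2 |b - 1| for every power b, and
  repeated squaring drives \<open>a\<close> away from 1.\<close>

lemma circle_no_small_subgroup:
  fixes a :: complex
  assumes "norm a = 1" "a \<noteq> 1"
  shows "\<exists>n::nat. norm (a ^ n - 1) \<ge> 1"
proof (rule ccontr)
  assume "\<not> ?thesis"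
  then have small: "norm (a ^ n - 1) < 1" for n by (auto simp: not_le)
  have re: "Re (a ^ n) > 1 / 2" for n
  proof -
    have "(norm (a ^ n - 1))\<^sup>2 < 1"
      using small[of n] by (simp add: power_less_one_iff)
    moreover have "(norm (a ^ n - 1))\<^sup>2 = 2 - 2 * Re (a ^ n)"
    proof -
      have "(norm (a ^ n))\<^sup>2 = 1" using assms(1) by (simp add: norm_power)
      then show ?thesis
        unfolding cmod_power2 by (simp add: power2_eq_square algebra_simps)
    qed
    ultimately show ?thesis by simp
  qed
  have grow: "(3 / 2) ^ k * norm (a - 1) \<le> norm (a ^ (2 ^ k) - 1)" for k
  proof (induction k)
    case (Suc k)
    let ?b = "a ^ (2 ^ k)"
    have "3 / 2 \<le> Re (?b + 1)" using re[of "2 ^ k"] by simp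
    also have "\<dots> \<le> norm (?b + 1)" by (rule complex_Re_le_cmod)
    finally have "(3 / 2) * norm (?b - 1) \<le> norm (?b + 1) * norm (?b - 1)"
      by (intro mult_right_mono) auto
    also have "\<dots> = norm (a ^ (2 ^ Suc k) - 1)"
    proof -
      have "a ^ (2 ^ Suc k) = ?b * ?b"
        by (simp add: mult_2 power_add)
      then have "a ^ (2 ^ Suc k) - 1 = (?b + 1) * (?b - 1)"
        by (simp add: algebra_simps)
      then show ?thesis by (simp only: norm_mult)
    qed
    finally show ?case using Suc by simp
  qed simp
  have "norm (a - 1) > 0" using assms by simp
  then obtain k where "1 / norm (a - 1) < (3 / 2) ^ k"
    using real_arch_pow[of "3/2" "1 / norm (a - 1)"] by auto
  then have "1 < (3 / 2) ^ k * norm (a - 1)"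
    using \<open>norm (a - 1) > 0\<close> by (simp add: field_simps)
  with grow[of k] small[of "2 ^ k"] show False by linarith
qed

text \<open>A continuous logarithm exists on the contractible line. Its imaginary part is additive
  up to a continuous defect with values in the multiples of 2 pi, which must vanish, and a
  continuous additive function is linear.\<close>

lemma real_character:
  fixes u :: "real \<Rightarrow> complex"
  assumes cont: "continuous_on UNIV u" and unit: "\<And>t. norm (u t) = 1"
    and add: "\<And>s t. u (s + t) = u s * u t"
  shows "\<exists>c. \<forall>t. u t = cis (c * t)"
proof -
  have "\<And>t. u t \<noteq> 0" using unit by (metis norm_zero zero_neq_one)
  then obtain g where g: "continuous_on UNIV g" "\<And>t. u t = exp (g t)"
    using continuous_logarithm_on_contractible[OF cont] by (metis UNIV_I contractible_UNIV)
  define \<theta> where "\<theta> t = Im (g t) - Im (g 0)" for t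
  have re: "Re (g t) = 0" for t
    using unit[of t] by (simp add: g)
  have ucis: "u t = cis (Im (g t))" for t
    by (simp add: g re exp_eq_polar)
  have u0: "u 0 = 1"
    using add[of 0 0] \<open>u 0 \<noteq> 0\<close> by simp
  have u: "u t = cis (\<theta> t)" for t
    using u0 ucis[of t] ucis[of 0] by (simp add: \<theta>_def cis_divide[symmetric])
  have \<theta>cont: "continuous_on UNIV \<theta>"
    unfolding \<theta>_def by (intro continuous_intros g)
  have \<theta>add: "\<theta> (s + t) = \<theta> s + \<theta> t" for s t
  proof -
    \<comment> \<open>The defect of additivity, measured in units of 2 pi. It is continuous and
      integer-valued, hence constant in \<open>t\<close>, and it is 0 at
      \<open>t = 0\<close>.\<close>
    define \<delta> where "\<delta> t = (\<theta> (s + t) - \<theta> s - \<theta> t) / (2 * pi)" for t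
    have \<delta>int: "\<delta> t \<in> \<int>" for t
    proof -
      have "cis (\<theta> (s + t) - \<theta> s - \<theta> t) = 1"
        using add[of s t] by (simp add: u cis_divide[symmetric])
      then have "cos (\<theta> (s + t) - \<theta> s - \<theta> t) = 1"
        by (metis cis.simps(1) one_complex.simps(1))
      then obtain n :: int where "\<theta> (s + t) - \<theta> s - \<theta> t = n * 2 * pi"
        by (auto simp: cos_one_2pi_int)
      then show ?thesis by (simp add: \<delta>_def)
    qed
    have \<delta>cont: "continuous_on UNIV \<delta>"
      unfolding \<delta>_def using \<theta>cont
      by (intro continuous_intros continuous_on_compose2[OF \<theta>cont, of _ "\<lambda>t. s + t"]) auto
    have "\<delta> constant_on UNIV"
    proof (rule continuous_discrete_range_constant[OF connected_UNIV \<delta>cont])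
      fix x
      show "\<exists>e>0. \<forall>y. y \<in> UNIV \<and> \<delta> y \<noteq> \<delta> x \<longrightarrow> e \<le> norm (\<delta> y - \<delta> x)"
        using Ints_nonzero_abs_ge1[OF Ints_diff[OF \<delta>int \<delta>int]]
        by (intro exI[of _ 1]) auto
    qed
    then have "\<delta> t = \<delta> 0"
      unfolding constant_on_def by force
    then show ?thesis by (simp add: \<delta>_def \<theta>_def)
  qed
  \<comment> \<open>The deviation from linearity is additive and zero at the integers, hence
    periodic and bounded. A nonzero value would be multiplied beyond every bound.\<close>
  define \<eta> where "\<eta> t = \<theta> t - \<theta> 1 * t" for t
  have \<eta>add: "\<eta> (s + t) = \<eta> s + \<eta> t" for s t by (simp add: \<eta>_def \<theta>add algebra_simps)
  have \<eta>mult: "\<eta> (real n * t) = n * \<eta> t" for n t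
    by (induction n) (auto simp: \<eta>add algebra_simps, use \<eta>add[of 0 0] in simp)
  have "\<eta> 1 = 0" by (simp add: \<eta>_def)
  then have \<eta>nat: "\<eta> (real n) = 0" for n using \<eta>mult[of n 1] by simp
  have \<eta>neg: "\<eta> (- t) = - \<eta> t" for t using \<eta>add[of t "-t"] \<eta>nat[of 0] by simp
  have \<eta>int: "\<eta> (of_int k) = 0" for k
    by (cases k rule: int_cases2) (use \<eta>nat \<eta>neg in auto)
  have "bounded (\<eta> ` {0..1})"
    unfolding \<eta>_def using \<theta>cont
    by (intro compact_imp_bounded compact_continuous_image continuous_intros)
       (auto intro: continuous_on_subset)
  then obtain B where B: "\<And>t. t \<in> {0..1} \<Longrightarrow> \<bar>\<eta> t\<bar> \<le> B"
    unfolding bounded_iff by (metis image_eqI real_norm_def)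
  have bd: "\<bar>\<eta> t\<bar> \<le> B" for t
  proof -
    have "\<eta> t = \<eta> (of_int \<lfloor>t\<rfloor> + frac t)" by (simp add: frac_def)
    also have "\<dots> = \<eta> (frac t)" by (simp add: \<eta>add \<eta>int)
    finally show ?thesis using B[of "frac t"] frac_lt_1[of t] by (simp add: less_imp_le)
  qed
  have \<eta>0: "\<eta> t = 0" for t
  proof (rule ccontr)
    assume "\<eta> t \<noteq> 0"
    then obtain n :: nat where "B / \<bar>\<eta> t\<bar> < n" using reals_Archimedean2 by blast
    then have "B < n * \<bar>\<eta> t\<bar>" using \<open>\<eta> t \<noteq> 0\<close> by (simp add: field_simps)
    then show False using bd[of "n * t"] by (simp add: \<eta>mult abs_mult)
  qed
  have "\<theta> t = \<theta> 1 * t" for t using \<eta>0[of t] by (simp add: \<eta>_def)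
  then show ?thesis using u by metis
qed

subsection \<open>Characters of finite support\<close>

text \<open>The elements of the free abelian group on the points of X, acting on C_p(X,T). Zero
  exponents are allowed, so \<open>S\<close> contains the support but may be larger.\<close>

definition fin_char :: "'a topology \<Rightarrow> (('a \<Rightarrow> complex) \<Rightarrow> complex) \<Rightarrow> bool" where
  "fin_char X \<xi> \<longleftrightarrow>
     (\<exists>S k. finite S \<and> S \<subseteq> topspace X \<and>
        (\<forall>f\<in>Cp_carrier X. \<xi> f = (\<Prod>x\<in>S. f x powi k x)))"

text \<open>Supplies the bump functions used throughout: complete regularity separates a closed
  point from a finite, hence compact, set.\<close>

lemma finite_separation:
  assumes X: "tychonoff_space X" and F: "finite F" "F \<subseteq> topspace X" and x: "x \<in> topspace X" "x \<notin> F"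
  obtains h where "continuous_map X euclideanreal h" "\<And>y. y \<in> topspace X \<Longrightarrow> h y \<in> {0..1}"
    "h x = 1" "\<And>y. y \<in> F \<Longrightarrow> h y = 0"
proof -
  have "Hausdorff_space X" "completely_regular_space X"
    using X by (auto simp: tychonoff_space_def)
  then have "closedin X {x}" "compactin X F"
    using F x by (auto simp: closedin_Hausdorff_singleton finite_imp_compactin)
  moreover have "disjnt {x} F" using x by (simp add: disjnt_def)
  ultimately obtain h where "continuous_map X (top_of_set {0..1::real}) h" "h ` F \<subseteq> {0}" "h ` {x} \<subseteq> {1}"
    using Urysohn_completely_regular_closed_compact[of 0 1 X "{x}" F] \<open>completely_regular_space X\<close>
    by (metis zero_le_one)
  then show thesis
    by (intro that[of h]) (auto simp: continuous_map_in_subtopology)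
qed

lemma Cp_separates_points:
  assumes X: "tychonoff_space X" and "x \<in> topspace X" "y \<in> topspace X" "x \<noteq> y"
  shows "\<exists>f\<in>Cp_carrier X. f x \<noteq> f y"
proof -
  obtain h where h: "continuous_map X euclideanreal h" "h x = 1" "h y = 0"
    using finite_separation[OF X, of "{y}" x] assms by auto
  have "cis pi \<noteq> cis 0" by simp
  then have "cis_map X (\<lambda>z. pi * h z) x \<noteq> cis_map X (\<lambda>z. pi * h z) y"
    using assms h by simp
  moreover have "cis_map X (\<lambda>z. pi * h z) \<in> Cp_carrier X"
    by (intro cis_map_in_Cp continuous_intros h)
  ultimately show ?thesis by blast
qed

text \<open>Turns a real function into a continuous one-parameter subgroup of C_p(X,T), along which
  a character becomes a character of the real line. Continuity is checked pointwise, coordinate by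
  coordinate.\<close>

lemma Cp_map_line_continuous:
  assumes "continuous_map X euclideanreal h"
  shows "continuous_map euclideanreal (Cp_top X) (\<lambda>t. cis_map X (\<lambda>x. t * h x))"
proof -
  have "continuous_map euclideanreal (product_topology (\<lambda>_. circle_top) (topspace X))
          (\<lambda>t. cis_map X (\<lambda>x. t * h x))"
    unfolding continuous_map_componentwise
  proof (intro conjI ballI)
    fix x assume "x \<in> topspace X"
    then have "(\<lambda>t. cis_map X (\<lambda>x. t * h x) x) = (\<lambda>t. cis (t * h x))" by simp
    moreover have "continuous_map euclideanreal euclidean (\<lambda>t. cis (t * h x))"
      by (intro continuous_map_cis continuous_intros) simp
    ultimately show "continuous_map euclideanreal circle_top (\<lambda>t. cis_map X (\<lambda>x. t * h x) x)"
      by (simp add: continuous_map_circle_iff)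
  qed (auto simp: cis_map_def)
  moreover have "cis_map X (\<lambda>x. t * h x) \<in> Cp_carrier X" for t
    by (intro cis_map_in_Cp continuous_intros assms) simp
  ultimately show ?thesis
    by (simp add: Cp_top_def continuous_map_in_subtopology image_subset_iff)
qed

text \<open>A basic neighbourhood of the neutral element restricts only the coordinates in a finite
  set \<open>F\<close>. The maps equal to 1 on \<open>F\<close> form a subgroup inside it, so their
  values under \<xi> form a subgroup of the circle close to 1, which is trivial.\<close>

lemma continuous_character_finite_kernel:
  assumes cont: "continuous_map (Cp_top X) circle_top \<xi>"
    and hom: "\<And>f g. f \<in> Cp_carrier X \<Longrightarrow> g \<in> Cp_carrier X \<Longrightarrow> \<xi> (Cp_mult X f g) = \<xi> f * \<xi> g"
  obtains F where "finite F" "F \<subseteq> topspace X"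
    "\<And>f. f \<in> Cp_carrier X \<Longrightarrow> (\<And>x. x \<in> F \<Longrightarrow> f x = 1) \<Longrightarrow> \<xi> f = 1"
proof -
  define e where "e = cis_map X (\<lambda>_. 0)"
  have e: "e \<in> Cp_carrier X" "\<And>x. x \<in> topspace X \<Longrightarrow> e x = 1"
    by (auto simp: e_def intro!: cis_map_in_Cp)
  have \<xi>: "norm (\<xi> f) = 1" if "f \<in> Cp_carrier X" for f
    using cont that by (simp add: continuous_map_circle_iff)
  have "Cp_mult X e e = e" by (rule Cp_carrier_eqI[of _ X]) (auto simp: e Cp_mult_in_Cp)
  then have "\<xi> e * \<xi> e = \<xi> e" using hom[OF e(1) e(1)] by simp
  then have \<xi>e: "\<xi> e = 1" using \<xi>[OF e(1)] by auto
  \<comment> \<open>The radius 1 matches the escape distance in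
    \<open>circle_no_small_subgroup\<close>.\<close>
  have "openin (Cp_top X) {f \<in> topspace (Cp_top X). \<xi> f \<in> ball 1 1}"
    using cont by (intro openin_continuous_map_preimage[where Y = euclidean])
      (auto simp: continuous_map_circle_iff)
  then obtain W where W: "openin (product_topology (\<lambda>_. circle_top) (topspace X)) W"
    "{f \<in> Cp_carrier X. \<xi> f \<in> ball 1 1} = W \<inter> Cp_carrier X"
    unfolding topspace_Cp_top unfolding Cp_top_def openin_subtopology by blast
  have "e \<in> W" using W(2) e \<xi>e by auto
  then obtain U where U: "finite {i \<in> topspace X. U i \<noteq> topspace circle_top}"
    "e \<in> Pi\<^sub>E (topspace X) U" "Pi\<^sub>E (topspace X) U \<subseteq> W"
    using W(1) unfolding openin_product_topology_alt by blast
  define F where "F = {i \<in> topspace X. U i \<noteq> topspace circle_top}"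
  have near: "norm (\<xi> f - 1) < 1" if f: "f \<in> Cp_carrier X" "\<And>x. x \<in> F \<Longrightarrow> f x = 1" for f
  proof -
    have "f x \<in> U x" if "x \<in> topspace X" for x
    proof (cases "x \<in> F")
      case True
      then show ?thesis using U(2) e(2)[OF that] f(2)[of x] that by (auto simp: PiE_iff)
    next
      case False
      then show ?thesis using that Cp_carrier_norm[OF f(1) that] by (auto simp: F_def circle_top_def)
    qed
    then have "f \<in> Pi\<^sub>E (topspace X) U" using f(1) by (auto simp: Cp_carrier_def PiE_iff)
    then have "f \<in> W \<inter> Cp_carrier X" using U(3) f(1) by blast
    then have "\<xi> f \<in> ball 1 1" using W(2) by blast
    then show ?thesis by (simp add: dist_norm norm_minus_commute)
  qed
  have "\<xi> f = 1" if f: "f \<in> Cp_carrier X" "\<And>x. x \<in> F \<Longrightarrow> f x = 1" for f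
  proof -
    \<comment> \<open>All powers of \<open>f\<close> are again 1 on \<open>F\<close>, so every power
      of \<open>\<xi> f\<close> stays near 1.\<close>
    define p where "p n = restrict (\<lambda>x. f x ^ n) (topspace X)" for n :: nat
    have pC: "p n \<in> Cp_carrier X" for n
      using f(1) unfolding p_def
      by (intro Cp_carrier_restrict)
        (auto simp: Cp_carrier_iff norm_power continuous_map_atin tendsto_power)
    have "\<xi> (p n) = \<xi> f ^ n" for n
    proof (induction n)
      case 0
      have "p 0 = e" by (rule Cp_carrier_eqI[OF pC e(1)]) (simp add: p_def e)
      then show ?case by (simp add: \<xi>e)
    next
      case (Suc n)
      have "p (Suc n) = Cp_mult X f (p n)"
        by (rule Cp_carrier_eqI[OF pC Cp_mult_in_Cp[OF f(1) pC]]) (simp add: p_def)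
      then show ?case using hom[OF f(1) pC] Suc by simp
    qed
    moreover have "norm (\<xi> (p n) - 1) < 1" for n
      by (rule near[OF pC]) (use f(2) in \<open>auto simp: p_def F_def\<close>)
    ultimately show ?thesis
      using circle_no_small_subgroup[OF \<xi>[OF f(1)]] by (metis not_le)
  qed
  then show thesis using U(1) by (intro that[of F]) (auto simp: F_def)
qed

text \<open>A character that is trivial on all maps equal to \<open>1\<close> on a finite set is determined on the
  one-parameter subgroups of bump functions, where it is given by an integer because \<open>2 * pi\<close>
  times a bump function has trivial exponential on the finite set.\<close>
theorem continuous_character_fin_char:
  assumes X: "tychonoff_space X"
    and cont: "continuous_map (Cp_top X) circle_top \<xi>"
    and hom: "\<And>f g. f \<in> Cp_carrier X \<Longrightarrow> g \<in> Cp_carrier X \<Longrightarrow> \<xi> (Cp_mult X f g) = \<xi> f * \<xi> g"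
  shows "fin_char X \<xi>"
proof -
  obtain F where F: "finite F" "F \<subseteq> topspace X"
    "\<And>f. f \<in> Cp_carrier X \<Longrightarrow> (\<And>x. x \<in> F \<Longrightarrow> f x = 1) \<Longrightarrow> \<xi> f = 1"
    using continuous_character_finite_kernel[OF cont hom] by metis
  \<comment> \<open>A system of bump functions dual to the points of \<open>F\<close>: each is 1 at
    its own point and 0 at the others.\<close>
  have "\<forall>x\<in>F. \<exists>h. continuous_map X euclideanreal h \<and> h x = 1 \<and> (\<forall>y\<in>F - {x}. h y = 0)"
  proof
    fix x assume "x \<in> F"
    then have "finite (F - {x})" "F - {x} \<subseteq> topspace X" "x \<in> topspace X" "x \<notin> F - {x}"
      using F by auto
    from finite_separation[OF X this]
    show "\<exists>h. continuous_map X euclideanreal h \<and> h x = 1 \<and> (\<forall>y\<in>F - {x}. h y = 0)"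
      by metis
  qed
  then obtain h where h: "\<And>x. x \<in> F \<Longrightarrow> continuous_map X euclideanreal (h x)"
    "\<And>x. x \<in> F \<Longrightarrow> h x x = 1" "\<And>x y. x \<in> F \<Longrightarrow> y \<in> F \<Longrightarrow> y \<noteq> x \<Longrightarrow> h x y = 0"
    by (metis DiffI singletonD)
  have "\<exists>k::int. \<forall>t. \<xi> (cis_map X (\<lambda>y. t * h x y)) = cis (k * t)" if x: "x \<in> F" for x
  proof -
    define u where "u t = \<xi> (cis_map X (\<lambda>y. t * h x y))" for t
    have C: "cis_map X (\<lambda>y. t * h x y) \<in> Cp_carrier X" for t
      by (intro cis_map_in_Cp continuous_intros h x) simp
    have "continuous_map euclideanreal circle_top (\<xi> \<circ> (\<lambda>t. cis_map X (\<lambda>y. t * h x y)))"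
      by (rule continuous_map_compose[OF Cp_map_line_continuous[OF h(1)[OF x]] cont])
    then have u: "continuous_map euclideanreal circle_top u"
      by (simp add: u_def[abs_def] o_def)
    have "u (s + t) = u s * u t" for s t
      unfolding u_def by (simp add: hom[OF C C, symmetric] Cp_mult_cis_map algebra_simps)
    then obtain c where c: "\<And>t. u t = cis (c * t)"
      using real_character[of u] u by (auto simp: continuous_map_circle_iff)
    have "u (2 * pi) = 1"
      unfolding u_def
    proof (rule F(3)[OF C])
      fix y assume "y \<in> F"
      then show "cis_map X (\<lambda>y. 2 * pi * h x y) y = 1"
        using h(2)[of y] h(3)[OF x, of y] F(2) by (cases "y = x") auto
    qed
    then have "cos (2 * pi * c) = 1"
      by (metis c cis.simps(1) one_complex.simps(1) mult.commute)
    then obtain k :: int where "2 * pi * c = k * 2 * pi"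
      by (auto simp: cos_one_2pi_int)
    then have "c = k" by simp
    with c show ?thesis unfolding u_def by blast
  qed
  then have "\<forall>x\<in>F. \<exists>k::int. \<forall>t. \<xi> (cis_map X (\<lambda>y. t * h x y)) = cis (k * t)" by blast
  from bchoice[OF this] obtain k :: "'a \<Rightarrow> int"
    where k: "\<And>x (t::real). x \<in> F \<Longrightarrow> \<xi> (cis_map X (\<lambda>y. t * h x y)) = cis (k x * t)"
    by blast
  have sumcont: "continuous_map X euclideanreal (\<lambda>y. \<Sum>x\<in>G. \<theta> x * h x y)" if "G \<subseteq> F" for G and \<theta> :: "'a \<Rightarrow> real"
    using that by (intro continuous_intros h) (auto simp: finite_subset[OF _ F(1)])
  have sum: "\<xi> (cis_map X (\<lambda>y. \<Sum>x\<in>G. \<theta> x * h x y)) = (\<Prod>x\<in>G. cis (k x * \<theta> x))"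
    if "G \<subseteq> F" for G and \<theta> :: "'a \<Rightarrow> real"
    using finite_subset[OF that F(1)] that
  proof (induction G rule: finite_induct)
    case empty
    show ?case by (auto intro!: F(3) cis_map_in_Cp) (use F(2) in auto)
  next
    case (insert x G)
    have "\<xi> (cis_map X (\<lambda>y. \<Sum>x\<in>insert x G. \<theta> x * h x y))
        = \<xi> (Cp_mult X (cis_map X (\<lambda>y. \<theta> x * h x y)) (cis_map X (\<lambda>y. \<Sum>x\<in>G. \<theta> x * h x y)))"
      using insert by (simp add: Cp_mult_cis_map)
    also have "\<dots> = cis (k x * \<theta> x) * (\<Prod>x\<in>G. cis (k x * \<theta> x))"
      using insert k[of x "\<theta> x"] sumcont[of G \<theta>]
      by (subst hom) (auto intro!: cis_map_in_Cp continuous_intros h)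
    finally show ?case using insert by simp
  qed
  have "\<xi> f = (\<Prod>x\<in>F. f x powi k x)" if f: "f \<in> Cp_carrier X" for f
  proof -
    \<comment> \<open>\<open>H\<close> interpolates the arguments of \<open>f\<close> on
      \<open>F\<close>. Dividing \<open>f\<close> by the exponential of \<open>H\<close> leaves a
      map that is 1 on \<open>F\<close>, so \<xi> takes the same value on \<open>f\<close> as on the
      exponential of a combination of bump functions.\<close>
    define \<theta> where "\<theta> x = Arg (f x)" for x
    define H where "H y = (\<Sum>x\<in>F. \<theta> x * h x y)" for y
    have f\<theta>: "f x = cis (\<theta> x)" if "x \<in> F" for x
      using cis_Arg[of "f x"] Cp_carrier_norm[OF f, of x] Cp_carrier_nonzero[OF f, of x] that F(2)
      by (auto simp: \<theta>_def sgn_div_norm)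
    have H: "continuous_map X euclideanreal H"
      unfolding H_def by (rule sumcont) simp
    have HF: "H y = \<theta> y" if y: "y \<in> F" for y
    proof -
      have "H y = (\<Sum>x\<in>F. if x = y then \<theta> y else 0)"
        unfolding H_def by (intro sum.cong refl) (use h(2,3) y in auto)
      then show ?thesis using y F(1) by simp
    qed
    have CH: "cis_map X H \<in> Cp_carrier X" and CmH: "cis_map X (\<lambda>y. - H y) \<in> Cp_carrier X"
      by (intro cis_map_in_Cp continuous_intros H)+
    define f' where "f' = Cp_mult X f (cis_map X (\<lambda>y. - H y))"
    have f': "f' \<in> Cp_carrier X" by (simp add: f'_def Cp_mult_in_Cp f CmH)
    have "\<xi> f' = 1"
      by (rule F(3)[OF f']) (use F(2) f\<theta> HF in \<open>auto simp: f'_def cis_mult\<close>)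
    moreover have "f = Cp_mult X f' (cis_map X H)"
      by (rule Cp_carrier_eqI[OF f Cp_mult_in_Cp[OF f' CH]]) (simp add: f'_def cis_mult mult.assoc)
    ultimately have "\<xi> f = \<xi> (cis_map X H)"
      using hom[OF f' CH] by simp
    also have "\<dots> = (\<Prod>x\<in>F. cis (k x * \<theta> x))"
      unfolding H_def by (rule sum) simp
    also have "\<dots> = (\<Prod>x\<in>F. f x powi k x)"
      by (intro prod.cong refl) (simp add: f\<theta> cis_power_int)
    finally show ?thesis .
  qed
  then show ?thesis unfolding fin_char_def using F by blast
qed

section \<open>Group operations on characters of finite support\<close>

lemma fin_charI:
  assumes "finite S" "S \<subseteq> topspace X"
    and "\<And>f. f \<in> Cp_carrier X \<Longrightarrow> \<xi> f = (\<Prod>x\<in>S. f x powi k x)"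
  shows "fin_char X \<xi>"
  using assms unfolding fin_char_def by blast

lemma fin_char_mult:
  assumes "fin_char X \<xi>" "fin_char X \<zeta>"
  shows "fin_char X (\<lambda>f. \<xi> f * \<zeta> f)"
proof -
  obtain S k where S: "finite S" "S \<subseteq> topspace X"
    "\<And>f. f \<in> Cp_carrier X \<Longrightarrow> \<xi> f = (\<Prod>x\<in>S. f x powi k x)"
    using assms(1) unfolding fin_char_def by blast
  obtain S' k' where S': "finite S'" "S' \<subseteq> topspace X"
    "\<And>f. f \<in> Cp_carrier X \<Longrightarrow> \<zeta> f = (\<Prod>x\<in>S'. f x powi k' x)"
    using assms(2) unfolding fin_char_def by blast
  \<comment> \<open>Both exponent functions are extended by 0, so that the two products can run over
    the same set \<open>S \<union> S'\<close>.\<close>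
  define l where "l x = (if x \<in> S then k x else 0)" for x
  define l' where "l' x = (if x \<in> S' then k' x else 0)" for x
  show ?thesis
  proof (rule fin_charI[of "S \<union> S'" _ _ "\<lambda>x. l x + l' x"])
    fix f assume f: "f \<in> Cp_carrier X"
    have "(\<Prod>x\<in>S \<union> S'. f x powi (l x + l' x))
        = (\<Prod>x\<in>S \<union> S'. f x powi l x) * (\<Prod>x\<in>S \<union> S'. f x powi l' x)"
      unfolding prod.distrib[symmetric]
      by (intro prod.cong refl power_int_add) (use Cp_carrier_nonzero[OF f] S(2) S'(2) in auto)
    also have "(\<Prod>x\<in>S \<union> S'. f x powi l x) = (\<Prod>x\<in>S. f x powi k x)"
      by (rule prod.mono_neutral_cong_right) (auto simp: S(1) S'(1) l_def)
    also have "(\<Prod>x\<in>S \<union> S'. f x powi l' x) = (\<Prod>x\<in>S'. f x powi k' x)"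
      by (rule prod.mono_neutral_cong_right) (auto simp: S(1) S'(1) l'_def)
    finally show "\<xi> f * \<zeta> f = (\<Prod>x\<in>S \<union> S'. f x powi (l x + l' x))"
      using S(3)[OF f] S'(3)[OF f] by simp
  qed (use S S' in auto)
qed

lemma prod_powi:
  fixes a :: "'i \<Rightarrow> complex"
  shows "(\<Prod>i\<in>I. a i) powi n = (\<Prod>i\<in>I. a i powi n)"
  by (induction I rule: infinite_finite_induct) (auto simp: power_int_mult_distrib)

lemma fin_char_powi:
  assumes "fin_char X \<xi>"
  shows "fin_char X (\<lambda>f. \<xi> f powi n)"
proof -
  obtain S k where S: "finite S" "S \<subseteq> topspace X"
    "\<And>f. f \<in> Cp_carrier X \<Longrightarrow> \<xi> f = (\<Prod>x\<in>S. f x powi k x)"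
    using assms(1) unfolding fin_char_def by blast
  show ?thesis
    by (rule fin_charI[of S _ _ "\<lambda>x. k x * n"])
      (use S in \<open>auto simp: prod_powi power_int_mult\<close>)
qed

lemma fin_char_prod_powi:
  assumes "finite I" "\<And>i. i \<in> I \<Longrightarrow> fin_char X (\<xi> i)"
  shows "fin_char X (\<lambda>f. \<Prod>i\<in>I. \<xi> i f powi n i)"
  using assms
proof (induction I rule: finite_induct)
  case empty
  show ?case by (rule fin_charI[of "{}"]) auto
next
  case (insert i I)
  then have "fin_char X (\<lambda>f. \<xi> i f powi n i * (\<Prod>i\<in>I. \<xi> i f powi n i))"
    by (intro fin_char_mult fin_char_powi) auto
  then show ?case using insert by simp
qed

text \<open>Evaluations are the characters with exponent sum \<open>1\<close> and no negative
  exponent: the former is detected by constant functions, the latter by bump functions.\<close>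
lemma fin_char_is_evaluation:
  assumes Y: "tychonoff_space Y" and fin: "fin_char Y \<xi>"
    and cl: "\<And>g. g \<in> Cp_carrier Y \<Longrightarrow> \<xi> g \<in> closure (g ` topspace Y)"
  shows "\<exists>y\<in>topspace Y. \<forall>g\<in>Cp_carrier Y. \<xi> g = g y"
proof -
  obtain S' k where S': "finite S'" "S' \<subseteq> topspace Y"
    "\<And>f. f \<in> Cp_carrier Y \<Longrightarrow> \<xi> f = (\<Prod>x\<in>S'. f x powi k x)"
    using fin unfolding fin_char_def by blast
  \<comment> \<open>Dropping the points with exponent 0 leaves the actual support.\<close>
  define S where "S = {x \<in> S'. k x \<noteq> 0}"
  have S: "finite S" "S \<subseteq> topspace Y" "\<And>x. x \<in> S \<Longrightarrow> k x \<noteq> 0"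
    using S' by (auto simp: S_def)
  have \<xi>: "\<xi> f = (\<Prod>x\<in>S. f x powi k x)" if "f \<in> Cp_carrier Y" for f
    unfolding S'(3)[OF that] by (rule prod.mono_neutral_right) (auto simp: S_def S')
  have sum1: "(\<Sum>x\<in>S. k x) = 1"
  proof (rule ccontr)
    define m where "m = (\<Sum>x\<in>S. k x) - 1"
    assume "(\<Sum>x\<in>S. k x) \<noteq> 1"
    then have m: "m \<noteq> 0" by (simp add: m_def)
    \<comment> \<open>For this constant the character has the value
      \<open>cis ((m + 1) * (pi / m))\<close>, the negative of the only value that \<open>g\<close>
      can take.\<close>
    define g where "g = cis_map Y (\<lambda>_. pi / m)"
    have g: "g \<in> Cp_carrier Y" unfolding g_def by (rule cis_map_in_Cp) simp
    have "\<xi> g = (\<Prod>x\<in>S. cis (k x * (pi / m)))"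
      unfolding \<xi>[OF g] by (intro prod.cong refl) (use S(2) in \<open>auto simp: g_def cis_power_int\<close>)
    also have "\<dots> = cis (\<Sum>x\<in>S. k x * (pi / m))"
      using S(1) by (induction S rule: finite_induct) (auto simp: cis_mult[symmetric])
    also have "(\<Sum>x\<in>S. k x * (pi / m)) = (m + 1) * (pi / m)"
    proof -
      have "(\<Sum>x\<in>S. k x * (pi / m)) = (\<Sum>x\<in>S. real_of_int (k x)) * (pi / m)"
        by (rule sum_distrib_right[symmetric])
      also have "(\<Sum>x\<in>S. real_of_int (k x)) = m + 1" by (simp add: m_def)
      finally show ?thesis .
    qed
    also have "\<dots> = pi + pi / m" using m by (simp add: field_simps)
    finally have "\<xi> g = - cis (pi / m)" by (simp add: cis_mult[symmetric])
    moreover have "closure (g ` topspace Y) \<subseteq> {cis (pi / m)}"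
      by (rule closure_minimal) (auto simp: g_def)
    ultimately show False using cl[OF g] cis_neq_zero[of "pi / m"] by auto
  qed
  have pos: "k x > 0" if x: "x \<in> S" for x
  proof (rule ccontr)
    assume "\<not> k x > 0"
    then have neg: "k x < 0" using S(3)[OF x] by simp
    have "finite (S - {x})" "S - {x} \<subseteq> topspace Y" "x \<in> topspace Y" "x \<notin> S - {x}"
      using S x by auto
    from finite_separation[OF Y this] obtain h where h: "continuous_map Y euclideanreal h"
      "\<And>y. y \<in> topspace Y \<Longrightarrow> h y \<in> {0..1}" "h x = 1" "\<And>y. y \<in> S - {x} \<Longrightarrow> h y = 0"
      by metis
    \<comment> \<open>The scaling makes \<open>\<xi> g = cis (- 1)\<close>, strictly below the real
      axis, whereas the values of \<open>g\<close> have angles in [0,1] and lie in the closed upper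
      half plane.\<close>
    define g where "g = cis_map Y (\<lambda>y. h y / - k x)"
    have g: "g \<in> Cp_carrier Y"
      unfolding g_def divide_inverse by (intro cis_map_in_Cp continuous_intros h) simp
    have "\<xi> g = (\<Prod>y\<in>S. if y = x then cis (- 1) else 1)"
      unfolding \<xi>[OF g]
      by (intro prod.cong refl) (use S(2) h(3,4) neg in \<open>auto simp: g_def cis_power_int\<close>)
    also have "\<dots> = cis (- 1)" using S(1) x by simp
    finally have "Im (\<xi> g) < 0" using sin_gt_zero[of 1] pi_gt3 by simp
    moreover have "closure (g ` topspace Y) \<subseteq> {z. 0 \<le> Im z}"
    proof (rule closure_minimal)
      show "g ` topspace Y \<subseteq> {z. 0 \<le> Im z}"
      proof clarsimp
        fix y assume y: "y \<in> topspace Y"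
        then have "0 \<le> h y / - k x" "h y / - k x \<le> 1"
          using h(2)[OF y] neg by (auto simp: field_simps)
        then show "0 \<le> Im (g y)"
          using y pi_gt3 sin_ge_zero[of "h y / - k x"] by (simp add: g_def)
      qed
      show "closed {z. 0 \<le> Im z}"
        by (intro closed_Collect_le continuous_intros)
    qed
    ultimately show False using cl[OF g] by auto
  qed
  obtain y where y: "y \<in> S" using sum1 by force
  \<comment> \<open>Positive integers with sum 1 consist of a single summand 1.\<close>
  have "int (card (S - {y})) \<le> (\<Sum>x\<in>S - {y}. k x)"
    using pos sum_mono[of "S - {y}" "\<lambda>_. 1" k] by force
  moreover have "k y + (\<Sum>x\<in>S - {y}. k x) = 1"
    using sum1 S(1) y by (simp add: sum.remove)
  ultimately have "card (S - {y}) = 0" "k y = 1" using pos[OF y] by linarith+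
  then have "S - {y} = {}" using S(1) by (metis card_0_eq finite_Diff)
  then have "S = {y}" using y by auto
  then show ?thesis using \<xi> \<open>k y = 1\<close> S(2) by (intro bexI[of _ y]) auto
qed

text \<open>A completely regular space has the initial topology of its circle-valued maps: a real
  function that is 0 at a point and 1 off a neighbourhood keeps these values apart after
  exponentiation, since \<open>cis 1\<close> differs from 1.\<close>

lemma continuous_map_into_completely_regular:
  assumes Y: "completely_regular_space Y" and p: "\<And>z. z \<in> topspace Z \<Longrightarrow> p z \<in> topspace Y"
    and cont: "\<And>g. g \<in> Cp_carrier Y \<Longrightarrow> continuous_map Z euclidean (\<lambda>z. g (p z))"
  shows "continuous_map Z Y p"
  unfolding continuous_map_def
proof (intro conjI allI impI)
  fix U assume U: "openin Y U"
  show "openin Z {z \<in> topspace Z. p z \<in> U}"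
  proof (subst openin_subopen, intro ballI)
    fix z assume "z \<in> {z \<in> topspace Z. p z \<in> U}"
    then have z: "z \<in> topspace Z" "p z \<in> U" by auto
    then obtain h where h: "continuous_map Y euclideanreal h" "h (p z) = 0"
      "h ` (topspace Y - U) \<subseteq> {1}"
      using Y U unfolding completely_regular_space_alt' by blast
    define W where "W = {w \<in> topspace Z. cis_map Y h (p w) \<in> - {cis 1}}"
    have "openin Z W"
      unfolding W_def using cont[OF cis_map_in_Cp[OF h(1)]]
      by (rule openin_continuous_map_preimage) auto
    moreover have "cis 1 \<noteq> 1"
      using sin_gt_zero[of 1] pi_gt3 by (auto simp: complex_eq_iff)
    then have "z \<in> W" using z p h(2) by (auto simp: W_def)
    moreover have "W \<subseteq> {z \<in> topspace Z. p z \<in> U}"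
      using p h(3) by (fastforce simp: W_def)
    ultimately show "\<exists>T. openin Z T \<and> z \<in> T \<and> T \<subseteq> {z \<in> topspace Z. p z \<in> U}" by blast
  qed
qed (use p in auto)

subsection \<open>Equivalence of the function groups in terms of supports\<close>

text \<open>Mutually inverse bijections with coordinates of finite support; the product formulas
  make both of them homomorphisms. The notion is symmetric in the two spaces, so each invariant has
  to be transferred in one direction only.\<close>

definition dual_equiv ::
  "'a topology \<Rightarrow> 'b topology \<Rightarrow> (('a \<Rightarrow> complex) \<Rightarrow> 'b \<Rightarrow> complex) \<Rightarrow> (('b \<Rightarrow> complex) \<Rightarrow> 'a \<Rightarrow> complex) \<Rightarrow> bool"
  where
  "dual_equiv X Y \<phi> \<psi> \<longleftrightarrow>
     (\<forall>f\<in>Cp_carrier X. \<phi> f \<in> Cp_carrier Y \<and> \<psi> (\<phi> f) = f) \<and>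
     (\<forall>g\<in>Cp_carrier Y. \<psi> g \<in> Cp_carrier X \<and> \<phi> (\<psi> g) = g) \<and>
     (\<forall>y\<in>topspace Y. fin_char X (\<lambda>f. \<phi> f y)) \<and>
     (\<forall>x\<in>topspace X. fin_char Y (\<lambda>g. \<psi> g x))"

lemma dual_equiv_sym: "dual_equiv X Y \<phi> \<psi> \<Longrightarrow> dual_equiv Y X \<psi> \<phi>"
  by (auto simp: dual_equiv_def)

lemma homomorphism_evaluation_fin_char:
  assumes X: "tychonoff_space X"
    and cont: "continuous_map (Cp_top X) (Cp_top Y) \<phi>"
    and hom: "\<And>f g. f \<in> Cp_carrier X \<Longrightarrow> g \<in> Cp_carrier X \<Longrightarrow> \<phi> (Cp_mult X f g) = Cp_mult Y (\<phi> f) (\<phi> g)"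
    and y: "y \<in> topspace Y"
  shows "fin_char X (\<lambda>f. \<phi> f y)"
proof (rule continuous_character_fin_char[OF X])
  have "continuous_map (Cp_top Y) circle_top (\<lambda>g. g y)"
    unfolding Cp_top_def
    by (rule continuous_map_from_subtopology[OF continuous_map_product_projection[OF y]])
  then show "continuous_map (Cp_top X) circle_top (\<lambda>f. \<phi> f y)"
    using continuous_map_compose[OF cont, of circle_top "\<lambda>g. g y"] by (simp add: o_def)
qed (simp add: hom y)

lemma Cp_top_isomorphic_dual_equiv:
  assumes X: "tychonoff_space X" and Y: "tychonoff_space Y" and iso: "Cp_top_isomorphic X Y"
  obtains \<phi> \<psi> where "dual_equiv X Y \<phi> \<psi>"
proof -
  obtain \<phi> where hom: "\<And>f g. f \<in> Cp_carrier X \<Longrightarrow> g \<in> Cp_carrier X \<Longrightarrow> \<phi> (Cp_mult X f g) = Cp_mult Y (\<phi> f) (\<phi> g)"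
    and homeo: "homeomorphic_map (Cp_top X) (Cp_top Y) \<phi>"
    using iso unfolding Cp_top_isomorphic_def by blast
  obtain \<psi> where \<psi>: "homeomorphic_maps (Cp_top X) (Cp_top Y) \<phi> \<psi>"
    using homeo homeomorphic_map_maps by blast
  have C: "\<phi> f \<in> Cp_carrier Y" "\<psi> (\<phi> f) = f" if "f \<in> Cp_carrier X" for f
    using \<psi> that by (auto simp: homeomorphic_maps_def continuous_map_def)
  have D: "\<psi> g \<in> Cp_carrier X" "\<phi> (\<psi> g) = g" if "g \<in> Cp_carrier Y" for g
    using \<psi> that by (auto simp: homeomorphic_maps_def continuous_map_def)
  have hom': "\<psi> (Cp_mult Y f g) = Cp_mult X (\<psi> f) (\<psi> g)"
    if "f \<in> Cp_carrier Y" "g \<in> Cp_carrier Y" for f g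
    using hom[OF D(1)[OF that(1)] D(1)[OF that(2)]] C(2)[OF Cp_mult_in_Cp[OF D(1)[OF that(1)] D(1)[OF that(2)]]]
    by (simp add: D that)
  have "continuous_map (Cp_top X) (Cp_top Y) \<phi>" "continuous_map (Cp_top Y) (Cp_top X) \<psi>"
    using \<psi> by (auto simp: homeomorphic_maps_def)
  then have "dual_equiv X Y \<phi> \<psi>"
    unfolding dual_equiv_def
    using C D homomorphism_evaluation_fin_char[OF X _ hom] homomorphism_evaluation_fin_char[OF Y _ hom']
    by blast
  then show thesis by (rule that)
qed

section \<open>Powers of Y as countable unions of images of closed parts of powers of X\<close>

lemma closedin_Collect_ball:
  assumes "\<And>a. a \<in> A \<Longrightarrow> closedin X {x \<in> topspace X. Q a x}"
  shows "closedin X {x \<in> topspace X. \<forall>a\<in>A. Q a x}"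
\<comment> \<open>The empty index set is treated apart because an intersection over no sets is the
  whole type and not \<open>topspace X\<close>.\<close>
proof (cases "A = {}")
  case False
  then have "{x \<in> topspace X. \<forall>a\<in>A. Q a x} = (\<Inter>a\<in>A. {x \<in> topspace X. Q a x})" by auto
  then show ?thesis using assms False by auto
qed simp

text \<open>The index \<open>c\<close> is an integer matrix with \<open>m\<close> rows: row \<open>i\<close> holds the exponents that
  express evaluation at the \<open>i\<close>-th coordinate in terms of evaluations at the \<open>N\<close> points.\<close>
lemma power_cover:
  fixes X :: "'a topology" and Y :: "'b topology" and m :: nat
  assumes Y: "tychonoff_space Y" and dual: "dual_equiv X Y \<phi> \<psi>"
  obtains P :: "nat \<Rightarrow> int list list \<Rightarrow> (nat \<Rightarrow> 'a) set" and p
  where "\<And>N c. closedin (product_topology (\<lambda>_. X) {..<N}) (P N c)"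
    and "\<And>N c. continuous_map (subtopology (product_topology (\<lambda>_. X) {..<N}) (P N c))
            (product_topology (\<lambda>_. Y) {..<m}) (p N c)"
    and "topspace (product_topology (\<lambda>_. Y) {..<m}) = (\<Union>N c. p N c ` P N c)"
proof -
  define XN where "XN N = product_topology (\<lambda>_::nat. X) {..<N}" for N
  \<comment> \<open>\<open>ev N c i x\<close> is the character of C_p(Y,T) that the points
    \<open>x\<close> and row \<open>i\<close> of \<open>c\<close> encode. \<open>P N c\<close>
    collects the tuples for which all \<open>m\<close> characters satisfy the closure criterion of
    \<open>fin_char_is_evaluation\<close>.\<close>
  define ev where "ev N c i x g = (\<Prod>j<N. \<psi> g (x j) powi (c ! i ! j))"
    for N :: nat and c :: "int list list" and i and x :: "nat \<Rightarrow> 'a" and g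
  define P where "P N c = {x \<in> topspace (XN N). \<forall>i\<in>{..<m}. \<forall>g\<in>Cp_carrier Y.
      ev N c i x g \<in> closure (g ` topspace Y)}" for N c
  \<comment> \<open>Picks the point at which the \<open>i\<close>-th character is evaluation; it is
    unique because circle-valued maps separate the points of Y.\<close>
  define q where "q N c x i = (SOME y. y \<in> topspace Y \<and> (\<forall>g\<in>Cp_carrier Y. ev N c i x g = g y))"
    for N c x i
  define p where "p N c x = restrict (q N c x) {..<m}" for N c x
  have \<psi>: "\<psi> g \<in> Cp_carrier X" if "g \<in> Cp_carrier Y" for g
    using dual that by (auto simp: dual_equiv_def)
  have q: "q N c x i \<in> topspace Y" "\<And>g. g \<in> Cp_carrier Y \<Longrightarrow> ev N c i x g = g (q N c x i)"
    if x: "x \<in> P N c" and i: "i < m" for N c x i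
  proof -
    have "x j \<in> topspace X" if "j < N" for j
      using x that by (auto simp: P_def XN_def PiE_iff)
    then have "fin_char Y (\<lambda>g. ev N c i x g)"
      unfolding ev_def by (intro fin_char_prod_powi) (use dual in \<open>auto simp: dual_equiv_def\<close>)
    then have "\<exists>y\<in>topspace Y. \<forall>g\<in>Cp_carrier Y. ev N c i x g = g y"
      by (rule fin_char_is_evaluation[OF Y]) (use x i in \<open>auto simp: P_def\<close>)
    then have "q N c x i \<in> topspace Y \<and> (\<forall>g\<in>Cp_carrier Y. ev N c i x g = g (q N c x i))"
      unfolding q_def by (rule someI_ex[OF bexE]) blast
    then show "q N c x i \<in> topspace Y" "\<And>g. g \<in> Cp_carrier Y \<Longrightarrow> ev N c i x g = g (q N c x i)"
      by auto
  qed
  have evcont: "continuous_map (XN N) euclidean (\<lambda>x. ev N c i x g)" if g: "g \<in> Cp_carrier Y" for N c i g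
    unfolding ev_def
  proof (intro continuous_map_prod_complex continuous_map_powi_complex)
    fix j assume j: "j \<in> {..<N}"
    have "continuous_map (XN N) X (\<lambda>x. x j)"
      unfolding XN_def using j by (rule continuous_map_product_projection)
    moreover have "continuous_map X euclidean (\<psi> g)" using \<psi>[OF g] by (simp add: Cp_carrier_iff)
    ultimately show "continuous_map (XN N) euclidean (\<lambda>x. \<psi> g (x j))"
      using continuous_map_compose by (fastforce simp: o_def)
    fix x assume "x \<in> topspace (XN N)"
    then show "\<psi> g (x j) \<noteq> 0"
      using j Cp_carrier_nonzero[OF \<psi>[OF g]] by (auto simp: XN_def PiE_iff)
  qed
  have closed: "closedin (XN N) (P N c)" for N c
    unfolding P_def
    by (intro closedin_Collect_ball closedin_continuous_map_preimage[OF evcont]) auto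
  \<comment> \<open>Continuity of \<open>p N c\<close> is tested by composing its coordinates with
    circle-valued maps on Y, which gives the continuous functions \<open>ev\<close>.\<close>
  have cont: "continuous_map (subtopology (XN N) (P N c)) (product_topology (\<lambda>_. Y) {..<m}) (p N c)" for N c
    unfolding continuous_map_componentwise
  proof (intro conjI ballI)
    fix i assume i: "i \<in> {..<m}"
    show "continuous_map (subtopology (XN N) (P N c)) Y (\<lambda>x. p N c x i)"
    proof (rule continuous_map_into_completely_regular)
      show "completely_regular_space Y" using Y by (simp add: tychonoff_space_def)
      fix g assume g: "g \<in> Cp_carrier Y"
      show "continuous_map (subtopology (XN N) (P N c)) euclidean (\<lambda>x. g (p N c x i))"
        by (rule continuous_map_eq[OF continuous_map_from_subtopology[OF evcont[OF g, of N c i]]])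
          (use i q(2)[OF _ _ g] in \<open>auto simp: p_def\<close>)
    qed (use i q(1) in \<open>auto simp: p_def\<close>)
  qed (auto simp: p_def)
  have "topspace (product_topology (\<lambda>_. Y) {..<m}) \<subseteq> (\<Union>N c. p N c ` P N c)"
  proof
    fix y assume "y \<in> topspace (product_topology (\<lambda>_. Y) {..<m})"
    then have y: "y \<in> {..<m} \<rightarrow>\<^sub>E topspace Y" by simp
    have "\<forall>i\<in>{..<m}. \<exists>S k. finite S \<and> S \<subseteq> topspace X \<and>
        (\<forall>f\<in>Cp_carrier X. \<phi> f (y i) = (\<Prod>x\<in>S. f x powi k x))"
      using dual y unfolding dual_equiv_def fin_char_def by (auto simp: PiE_iff)
    then obtain S k where Sk: "\<forall>i\<in>{..<m}. finite (S i) \<and> S i \<subseteq> topspace X \<and>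
        (\<forall>f\<in>Cp_carrier X. \<phi> f (y i) = (\<Prod>x\<in>S i. f x powi k i x))"
      unfolding bchoice_iff by blast
    then have S: "\<And>i. i < m \<Longrightarrow> finite (S i)" "\<And>i. i < m \<Longrightarrow> S i \<subseteq> topspace X"
      "\<And>i f. i < m \<Longrightarrow> f \<in> Cp_carrier X \<Longrightarrow> \<phi> f (y i) = (\<Prod>x\<in>S i. f x powi k i x)"
      by blast+
    \<comment> \<open>The supports of all \<open>m\<close> evaluations are pooled into one list
      \<open>xs\<close>; exponents are 0 outside the individual supports, so a single tuple of
      points serves every row of the matrix \<open>c\<close>.\<close>
    define T where "T = (\<Union>i<m. S i)"
    have "finite T" using S(1) by (auto simp: T_def)
    then obtain xs where xs: "set xs = T" "distinct xs" using finite_distinct_list by blast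
    define N where "N = length xs"
    define l where "l i x = (if x \<in> S i then k i x else 0)" for i x
    define c where "c = map (\<lambda>i. map (l i) xs) [0..<m]"
    define x where "x = restrict (\<lambda>j. xs ! j) {..<N}"
    have xT: "x j \<in> topspace X" if "j < N" for j
      using that S(2) xs(1) nth_mem[of j xs] by (auto simp: x_def N_def T_def)
    have ev: "ev N c i x g = g (y i)" if i: "i < m" and g: "g \<in> Cp_carrier Y" for i g
    proof -
      have "ev N c i x g = (\<Prod>j<N. \<psi> g (xs ! j) powi l i (xs ! j))"
        unfolding ev_def by (intro prod.cong refl) (use i in \<open>auto simp: x_def c_def N_def\<close>)
      also have "\<dots> = (\<Prod>z\<in>T. \<psi> g z powi l i z)"
        by (rule prod.reindex_bij_betw[of "\<lambda>j. xs ! j" "{..<N}" T "\<lambda>z. \<psi> g z powi l i z"])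
          (use bij_betw_nth[OF xs(2)] xs(1) in \<open>simp add: N_def\<close>)
      also have "\<dots> = (\<Prod>z\<in>S i. \<psi> g z powi k i z)"
        by (rule prod.mono_neutral_cong_right) (use \<open>finite T\<close> i in \<open>auto simp: T_def l_def\<close>)
      also have "\<dots> = \<phi> (\<psi> g) (y i)" using S(3)[OF i \<psi>[OF g]] by simp
      also have "\<dots> = g (y i)" using dual g by (simp add: dual_equiv_def)
      finally show ?thesis .
    qed
    have "x \<in> P N c"
      using xT ev y closure_subset
      by (fastforce simp: P_def XN_def x_def PiE_iff)
    moreover have "p N c x = y"
    proof
      fix i
      show "p N c x i = y i"
      proof (cases "i < m")
        case True
        then have "g (q N c x i) = g (y i)" if "g \<in> Cp_carrier Y" for g
          using q(2)[OF \<open>x \<in> P N c\<close> True that] ev[OF True that] by simp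
        then have "q N c x i = y i"
          using Cp_separates_points[OF Y q(1)[OF \<open>x \<in> P N c\<close> True], of "y i"] y True
          by (auto simp: PiE_iff)
        then show ?thesis using True by (simp add: p_def)
      next
        case False
        then show ?thesis using y by (auto simp: p_def PiE_iff extensional_def)
      qed
    qed
    ultimately show "y \<in> (\<Union>N c. p N c ` P N c)" by blast
  qed
  moreover have "p N c ` P N c \<subseteq> topspace (product_topology (\<lambda>_. Y) {..<m})" for N c
    using q(1) by (auto simp: p_def split: if_splits)
  ultimately show thesis
    using closed cont unfolding XN_def by (intro that[of P p] equalityI UN_least) blast+
qed

text \<open>The case of the first power of Y, with its only coordinate projected out.\<close>

lemma dual_equiv_cover:
  fixes X :: "'a topology" and Y :: "'b topology"
  assumes Y: "tychonoff_space Y" and dual: "dual_equiv X Y \<phi> \<psi>"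
  obtains P :: "nat \<Rightarrow> int list list \<Rightarrow> (nat \<Rightarrow> 'a) set" and p
  where "\<And>N c. closedin (product_topology (\<lambda>_. X) {..<N}) (P N c)"
    and "\<And>N c. continuous_map (subtopology (product_topology (\<lambda>_. X) {..<N}) (P N c)) Y (p N c)"
    and "topspace Y = (\<Union>N c. p N c ` P N c)"
proof -
  obtain P :: "nat \<Rightarrow> int list list \<Rightarrow> (nat \<Rightarrow> 'a) set" and p
  where P: "\<And>N c. closedin (product_topology (\<lambda>_. X) {..<N}) (P N c)"
    "\<And>N c. continuous_map (subtopology (product_topology (\<lambda>_. X) {..<N}) (P N c))
            (product_topology (\<lambda>_. Y) {..<1::nat}) (p N c)"
    "topspace (product_topology (\<lambda>_. Y) {..<1::nat}) = (\<Union>N c. p N c ` P N c)"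
    by (rule power_cover[where m = 1, OF Y dual]) (rule that)
  have proj: "continuous_map (product_topology (\<lambda>_. Y) {..<1::nat}) Y (\<lambda>y. y 0)"
    by (rule continuous_map_product_projection) simp
  have "continuous_map (subtopology (product_topology (\<lambda>_. X) {..<N}) (P N c)) Y (\<lambda>x. p N c x 0)" for N c
    using continuous_map_compose[OF P(2) proj] by (simp add: o_def)
  moreover have "topspace Y = (\<lambda>y. y 0) ` topspace (product_topology (\<lambda>_. Y) {..<1::nat})"
  proof
    show "topspace Y \<subseteq> (\<lambda>y. y 0) ` topspace (product_topology (\<lambda>_. Y) {..<1::nat})"
    proof
      fix y assume "y \<in> topspace Y"
      then have "restrict (\<lambda>_. y) {..<1::nat} \<in> topspace (product_topology (\<lambda>_. Y) {..<1::nat})"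
        by auto
      then show "y \<in> (\<lambda>y. y 0) ` topspace (product_topology (\<lambda>_. Y) {..<1::nat})"
        by (rule rev_image_eqI) simp
    qed
  qed auto
  then have "topspace Y = (\<Union>N c. (\<lambda>x. p N c x 0) ` P N c)"
    unfolding P(3) by (simp add: image_UN image_image)
  ultimately show thesis by (intro that[OF P(1)])
qed

subsection \<open>Lindelof numbers of powers\<close>

lemma lepoll_iff_card_of_ordLeq: "B \<lesssim> K \<longleftrightarrow> (card_of B, card_of K) \<in> ordLeq"
  by (simp add: lepoll_def card_of_ordLeq)

lemma countable_UN_lepoll:
  assumes "countable I" "infinite K" "\<And>i. i \<in> I \<Longrightarrow> A i \<lesssim> K"
  shows "(\<Union>i\<in>I. A i) \<lesssim> K"
proof -
  have "I \<lesssim> (UNIV :: nat set)"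
    using assms(1) by (auto simp: countable_def lepoll_def)
  then have "I \<lesssim> K"
    using assms(2) infinite_le_lepoll lepoll_trans by blast
  then show ?thesis
    using assms(2,3) card_of_UNION_ordLeq_infinite[of K I A]
    by (simp add: lepoll_iff_card_of_ordLeq)
qed

text \<open>The cover is pulled back to \<open>P\<close> and extended to open sets of
  \<open>Z\<close>; together with the complement of the closed set \<open>P\<close> these cover
  \<open>Z\<close>, where a small subcover exists.\<close>

lemma lindelof_number_le_closed_image:
  assumes Z: "lindelof_number_le Z K" and P: "closedin Z P"
    and p: "continuous_map (subtopology Z P) W p"
    and U: "\<And>U. U \<in> \<U> \<Longrightarrow> openin W U" "p ` P \<subseteq> \<Union>\<U>"
  shows "\<exists>\<V>\<subseteq>\<U>. p ` P \<subseteq> \<Union>\<V> \<and> \<V> \<lesssim> K"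
proof -
  have PZ: "P \<subseteq> topspace Z" using P by (rule closedin_subset)
  have "\<forall>U\<in>\<U>. \<exists>G. openin Z G \<and> {x \<in> P. p x \<in> U} = G \<inter> P"
  proof
    fix U assume "U \<in> \<U>"
    then have "openin (subtopology Z P) {x \<in> topspace (subtopology Z P). p x \<in> U}"
      using U(1) p by (intro openin_continuous_map_preimage)
    moreover have "{x \<in> topspace (subtopology Z P). p x \<in> U} = {x \<in> P. p x \<in> U}" using PZ by auto
    ultimately show "\<exists>G. openin Z G \<and> {x \<in> P. p x \<in> U} = G \<inter> P"
      by (simp add: openin_subtopology)
  qed
  then obtain G where G: "\<And>U. U \<in> \<U> \<Longrightarrow> openin Z (G U)"
    "\<And>U. U \<in> \<U> \<Longrightarrow> {x \<in> P. p x \<in> U} = G U \<inter> P"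
    by metis
  define \<C> where "\<C> = insert (topspace Z - P) (G ` \<U>)"
  have "\<forall>C\<in>\<C>. openin Z C" using G(1) P by (auto simp: \<C>_def closedin_def)
  moreover have "topspace Z \<subseteq> \<Union>\<C>"
  proof
    fix x assume x: "x \<in> topspace Z"
    show "x \<in> \<Union>\<C>"
    proof (cases "x \<in> P")
      case True
      then obtain U where "U \<in> \<U>" "p x \<in> U" using U(2) by blast
      then have "x \<in> G U" using G(2) True by blast
      then show ?thesis using \<open>U \<in> \<U>\<close> by (auto simp: \<C>_def)
    qed (use x in \<open>auto simp: \<C>_def\<close>)
  qed
  ultimately obtain \<D> where \<D>: "\<D> \<subseteq> \<C>" "topspace Z \<subseteq> \<Union>\<D>" "\<D> \<lesssim> K"
    using Z unfolding lindelof_number_le_def by meson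
  \<comment> \<open>One member of the given family is chosen for each selected set of the form
    \<open>G U\<close>, so \<V> is no larger than \<D>. These sets already cover \<open>P\<close>,
    since the complement of \<open>P\<close> contains none of its points.\<close>
  define \<V> where "\<V> = inv_into \<U> G ` (\<D> \<inter> G ` \<U>)"
  have "\<V> \<subseteq> \<U>" by (auto simp: \<V>_def inv_into_into)
  moreover have "p ` P \<subseteq> \<Union>\<V>"
  proof clarify
    fix x assume x: "x \<in> P"
    then obtain D where D: "D \<in> \<D>" "x \<in> D" using \<D>(2) PZ by blast
    then have "D \<in> G ` \<U>" using \<D>(1) x by (auto simp: \<C>_def)
    then have "inv_into \<U> G D \<in> \<U>" "G (inv_into \<U> G D) = D"
      by (auto simp: inv_into_into f_inv_into_f)
    then have "p x \<in> inv_into \<U> G D" using G(2) D(2) x by blast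
    then show "p x \<in> \<Union>\<V>" using D \<open>D \<in> G ` \<U>\<close> by (auto simp: \<V>_def)
  qed
  moreover have "\<V> \<lesssim> K"
    unfolding \<V>_def
    by (meson \<D>(3) image_lepoll inf_le1 lepoll_trans subset_imp_lepoll)
  ultimately show ?thesis by blast
qed

text \<open>Each piece of the cover of the power of Y needs at most |K| open sets, and there are
  countably many pieces because integer matrices are countable. The infinite \<open>K\<close>
  absorbs the countable union.\<close>

lemma dual_equiv_lstar_le:
  fixes X :: "'a topology" and Y :: "'b topology" and K :: "'c set"
  assumes Y: "tychonoff_space Y" and dual: "dual_equiv X Y \<phi> \<psi>" and K: "infinite K"
    and X: "lstar_le X K"
  shows "lstar_le Y K"
  unfolding lstar_le_def lindelof_number_le_def
proof (intro allI impI, elim conjE)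
  fix m and \<U> :: "(nat \<Rightarrow> 'b) set set"
  assume \<U>: "\<forall>U\<in>\<U>. openin (product_topology (\<lambda>_. Y) {..<m}) U"
    "topspace (product_topology (\<lambda>_. Y) {..<m}) \<subseteq> \<Union>\<U>"
  obtain P :: "nat \<Rightarrow> int list list \<Rightarrow> (nat \<Rightarrow> 'a) set" and p
  where P: "\<And>N c. closedin (product_topology (\<lambda>_. X) {..<N}) (P N c)"
    "\<And>N c. continuous_map (subtopology (product_topology (\<lambda>_. X) {..<N}) (P N c))
            (product_topology (\<lambda>_. Y) {..<m}) (p N c)"
    "topspace (product_topology (\<lambda>_. Y) {..<m}) = (\<Union>N c. p N c ` P N c)"
    by (rule power_cover[where m = m, OF Y dual]) (rule that)
  have "\<exists>\<V>\<subseteq>\<U>. p N c ` P N c \<subseteq> \<Union>\<V> \<and> \<V> \<lesssim> K" for N c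
  proof (rule lindelof_number_le_closed_image[OF _ P(1) P(2)])
    show "lindelof_number_le (product_topology (\<lambda>_. X) {..<N}) K"
      using X by (simp add: lstar_le_def)
    show "p N c ` P N c \<subseteq> \<Union>\<U>" using \<U>(2) P(3) by blast
  qed (use \<U>(1) in auto)
  then obtain \<V> where \<V>: "\<And>N c. \<V> N c \<subseteq> \<U>" "\<And>N c. p N c ` P N c \<subseteq> \<Union>(\<V> N c)" "\<And>N c. \<V> N c \<lesssim> K"
    by metis
  have "(\<Union>i\<in>UNIV. case i of (N, c) \<Rightarrow> \<V> N c) \<lesssim> K"
    using \<V>(3) by (intro countable_UN_lepoll K) auto
  moreover have "(\<Union>i\<in>UNIV. case i of (N, c) \<Rightarrow> \<V> N c) \<subseteq> \<U>" using \<V>(1) by auto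
  moreover have "topspace (product_topology (\<lambda>_. Y) {..<m}) \<subseteq> \<Union>(\<Union>i\<in>UNIV. case i of (N, c) \<Rightarrow> \<V> N c)"
    unfolding P(3) using \<V>(2) by (fastforce simp: subset_iff)
  ultimately show "\<exists>\<V>\<subseteq>\<U>. topspace (product_topology (\<lambda>_. Y) {..<m}) \<subseteq> \<Union>\<V> \<and> \<V> \<lesssim> K" by blast
qed

subsection \<open>Lindelof Sigma-spaces and sigma-compactness\<close>

lemma lindelof_sigma_spaceE:
  assumes "lindelof_sigma_space X"
  obtains \<N> \<C> where "countable \<N>" "\<And>C. C \<in> \<C> \<Longrightarrow> compactin X C" "\<Union>\<C> = topspace X"
    "\<And>C U. C \<in> \<C> \<Longrightarrow> openin X U \<Longrightarrow> C \<subseteq> U \<Longrightarrow> \<exists>N\<in>\<N>. C \<subseteq> N \<and> N \<subseteq> U"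
proof -
  obtain \<N> \<C> where "countable \<N> \<and> (\<forall>C\<in>\<C>. compactin X C) \<and> \<Union>\<C> = topspace X \<and>
      (\<forall>C\<in>\<C>. \<forall>U. openin X U \<and> C \<subseteq> U \<longrightarrow> (\<exists>N\<in>\<N>. C \<subseteq> N \<and> N \<subseteq> U))"
    using assms unfolding lindelof_sigma_space_def by (elim exE) (rule that)
  then show thesis by (intro that[of \<N> \<C>]) simp_all
qed

lemma lindelof_sigma_spaceI:
  assumes "countable \<N>" "\<And>C. C \<in> \<C> \<Longrightarrow> compactin X C" "\<Union>\<C> = topspace X"
    "\<And>C U. C \<in> \<C> \<Longrightarrow> openin X U \<Longrightarrow> C \<subseteq> U \<Longrightarrow> \<exists>N\<in>\<N>. C \<subseteq> N \<and> N \<subseteq> U"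
  shows "lindelof_sigma_space X"
  unfolding lindelof_sigma_space_def
  by (intro exI[of _ \<N>] exI[of _ \<C>]) (simp add: assms)

lemma lindelof_sigma_closed_subspace:
  assumes Z: "lindelof_sigma_space Z" and P: "closedin Z P"
  shows "lindelof_sigma_space (subtopology Z P)"
proof -
  obtain \<N> \<C> where NC: "countable \<N>" "\<And>C. C \<in> \<C> \<Longrightarrow> compactin Z C" "\<Union>\<C> = topspace Z"
    "\<And>C U. C \<in> \<C> \<Longrightarrow> openin Z U \<Longrightarrow> C \<subseteq> U \<Longrightarrow> \<exists>N\<in>\<N>. C \<subseteq> N \<and> N \<subseteq> U"
    by (rule lindelof_sigma_spaceE[OF Z]) (rule that)
  show ?thesis
  proof (rule lindelof_sigma_spaceI[of "(\<lambda>N. N \<inter> P) ` \<N>" "(\<lambda>C. C \<inter> P) ` \<C>"])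
    show "compactin (subtopology Z P) C" if "C \<in> (\<lambda>C. C \<inter> P) ` \<C>" for C
      using that NC(2) P by (auto simp: compactin_subtopology compact_Int_closedin)
    show "\<Union>((\<lambda>C. C \<inter> P) ` \<C>) = topspace (subtopology Z P)"
      using NC(3) by auto
    fix C U assume C: "C \<in> (\<lambda>C. C \<inter> P) ` \<C>" "openin (subtopology Z P) U" "C \<subseteq> U"
    then obtain D V where D: "D \<in> \<C>" "C = D \<inter> P" and V: "openin Z V" "U = V \<inter> P"
      by (auto simp: openin_subtopology)
    \<comment> \<open>Only the part of \<open>D\<close> in \<open>P\<close> lies in
      \<open>V\<close>; adding the complement of \<open>P\<close> gives an open set around all of
      \<open>D\<close>, to which the network property applies.\<close>
    have "openin Z (V \<union> (topspace Z - P))" using V(1) P by (auto simp: closedin_def)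
    moreover have "D \<subseteq> V \<union> (topspace Z - P)" using NC(3) D C(3) V(2) by blast
    ultimately obtain N where "N \<in> \<N>" "D \<subseteq> N" "N \<subseteq> V \<union> (topspace Z - P)"
      using NC(4)[OF D(1)] by blast
    then show "\<exists>N\<in>(\<lambda>N. N \<inter> P) ` \<N>. C \<subseteq> N \<and> N \<subseteq> U"
      using D(2) V(2) by (intro bexI[of _ "N \<inter> P"]) auto
  qed (use NC(1) in auto)
qed

lemma lindelof_sigma_continuous_image:
  assumes Z: "lindelof_sigma_space Z" and f: "continuous_map Z W f"
  shows "lindelof_sigma_space (subtopology W (f ` topspace Z))"
proof -
  obtain \<N> \<C> where NC: "countable \<N>" "\<And>C. C \<in> \<C> \<Longrightarrow> compactin Z C" "\<Union>\<C> = topspace Z"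
    "\<And>C U. C \<in> \<C> \<Longrightarrow> openin Z U \<Longrightarrow> C \<subseteq> U \<Longrightarrow> \<exists>N\<in>\<N>. C \<subseteq> N \<and> N \<subseteq> U"
    by (rule lindelof_sigma_spaceE[OF Z]) (rule that)
  show ?thesis
  proof (rule lindelof_sigma_spaceI[of "(`) f ` \<N>" "(`) f ` \<C>"])
    show "compactin (subtopology W (f ` topspace Z)) C" if "C \<in> (`) f ` \<C>" for C
      using that NC(2,3) f by (auto simp: compactin_subtopology intro!: image_compactin)
    show "\<Union>((`) f ` \<C>) = topspace (subtopology W (f ` topspace Z))"
      using continuous_map_image_subset_topspace[OF f]
      by (simp add: NC(3) Int_absorb1 flip: image_Union)
    fix C U assume C: "C \<in> (`) f ` \<C>" "openin (subtopology W (f ` topspace Z)) U" "C \<subseteq> U"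
    then obtain D V where D: "D \<in> \<C>" "C = f ` D" and V: "openin W V" "U = V \<inter> f ` topspace Z"
      by (auto simp: openin_subtopology)
    have "openin Z {z \<in> topspace Z. f z \<in> V}" using V(1) f by (simp add: openin_continuous_map_preimage)
    moreover have "D \<subseteq> {z \<in> topspace Z. f z \<in> V}" using NC(3) D C(3) V(2) by blast
    ultimately obtain N where "N \<in> \<N>" "D \<subseteq> N" "N \<subseteq> {z \<in> topspace Z. f z \<in> V}"
      using NC(4)[OF D(1)] by blast
    then show "\<exists>N\<in>(`) f ` \<N>. C \<subseteq> N \<and> N \<subseteq> U"
      using D(2) V(2) by (intro bexI[of _ "f ` N"]) auto
  qed (use NC(1) in auto)
qed

text \<open>The union of countably many countable networks is a countable network for the union of
  the compact families.\<close>

lemma lindelof_sigma_countable_union: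
  assumes I: "countable I" and S: "\<And>i. i \<in> I \<Longrightarrow> lindelof_sigma_space (subtopology W (S i))"
    and cover: "topspace W = (\<Union>i\<in>I. S i)"
  shows "lindelof_sigma_space W"
proof -
  have "\<forall>i\<in>I. \<exists>\<N> \<C>. countable \<N> \<and> (\<forall>C\<in>\<C>. compactin (subtopology W (S i)) C) \<and>
      \<Union>\<C> = topspace (subtopology W (S i)) \<and>
      (\<forall>C\<in>\<C>. \<forall>U. openin (subtopology W (S i)) U \<and> C \<subseteq> U \<longrightarrow> (\<exists>N\<in>\<N>. C \<subseteq> N \<and> N \<subseteq> U))"
    by (rule ballI) (rule S[unfolded lindelof_sigma_space_def])
  then obtain \<N> \<C> where NC: "\<forall>i\<in>I. countable (\<N> i) \<and> (\<forall>C\<in>\<C> i. compactin (subtopology W (S i)) C) \<and>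
      \<Union>(\<C> i) = topspace (subtopology W (S i)) \<and>
      (\<forall>C\<in>\<C> i. \<forall>U. openin (subtopology W (S i)) U \<and> C \<subseteq> U \<longrightarrow> (\<exists>N\<in>\<N> i. C \<subseteq> N \<and> N \<subseteq> U))"
    unfolding bchoice_iff by (elim exE) (rule that)
  show ?thesis
  proof (rule lindelof_sigma_spaceI[of "\<Union>i\<in>I. \<N> i" "\<Union>i\<in>I. \<C> i"])
    show "countable (\<Union>i\<in>I. \<N> i)" using I NC by blast
    show "compactin W C" if "C \<in> (\<Union>i\<in>I. \<C> i)" for C
      using that NC by (auto simp: compactin_subtopology)
    have "\<Union>(\<C> i) = S i" if "i \<in> I" for i
      using NC that cover by (auto simp: topspace_subtopology)
    then show "\<Union>(\<Union>i\<in>I. \<C> i) = topspace W" unfolding cover by blast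
    fix C U assume C: "C \<in> (\<Union>i\<in>I. \<C> i)" "openin W U" "C \<subseteq> U"
    then obtain i where i: "i \<in> I" "C \<in> \<C> i" by blast
    have "openin (subtopology W (S i)) (U \<inter> S i)" using C(2) by (auto simp: openin_subtopology)
    moreover have "C \<subseteq> U \<inter> S i" using C(3) NC i by (auto simp: compactin_subtopology)
    ultimately obtain N where "N \<in> \<N> i" "C \<subseteq> N" "N \<subseteq> U \<inter> S i" using NC i by metis
    then show "\<exists>N\<in>(\<Union>i\<in>I. \<N> i). C \<subseteq> N \<and> N \<subseteq> U" using i(1) by blast
  qed
qed

text \<open>Wallace's theorem fits an open box between a product of two compact sets and an open set
  around it, so boxes of network members form a network.\<close>

lemma lindelof_sigma_prod:
  assumes A: "lindelof_sigma_space A" and B: "lindelof_sigma_space B"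
  shows "lindelof_sigma_space (prod_topology A B)"
proof -
  obtain \<N> \<C> where NC: "countable \<N>" "\<And>C. C \<in> \<C> \<Longrightarrow> compactin A C" "\<Union>\<C> = topspace A"
    "\<And>C U. C \<in> \<C> \<Longrightarrow> openin A U \<Longrightarrow> C \<subseteq> U \<Longrightarrow> \<exists>N\<in>\<N>. C \<subseteq> N \<and> N \<subseteq> U"
    by (rule lindelof_sigma_spaceE[OF A]) (rule that)
  obtain \<M> \<D> where MD: "countable \<M>" "\<And>C. C \<in> \<D> \<Longrightarrow> compactin B C" "\<Union>\<D> = topspace B"
    "\<And>C U. C \<in> \<D> \<Longrightarrow> openin B U \<Longrightarrow> C \<subseteq> U \<Longrightarrow> \<exists>N\<in>\<M>. C \<subseteq> N \<and> N \<subseteq> U"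
    by (rule lindelof_sigma_spaceE[OF B]) (rule that)
  show ?thesis
  proof (rule lindelof_sigma_spaceI[of "(\<lambda>(M, N). M \<times> N) ` (\<N> \<times> \<M>)" "(\<lambda>(M, N). M \<times> N) ` (\<C> \<times> \<D>)"])
    show "compactin (prod_topology A B) C" if "C \<in> (\<lambda>(M, N). M \<times> N) ` (\<C> \<times> \<D>)" for C
      using that NC(2) MD(2) by (auto simp: compactin_Times)
    show "\<Union>((\<lambda>(M, N). M \<times> N) ` (\<C> \<times> \<D>)) = topspace (prod_topology A B)"
      using NC(3) MD(3) by (fastforce simp: topspace_prod_topology)
    fix C U assume C: "C \<in> (\<lambda>(M, N). M \<times> N) ` (\<C> \<times> \<D>)" "openin (prod_topology A B) U" "C \<subseteq> U"
    then obtain E F where E: "E \<in> \<C>" "F \<in> \<D>" "C = E \<times> F" by auto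
    obtain V W where VW: "openin A V" "openin B W" "E \<subseteq> V" "F \<subseteq> W" "V \<times> W \<subseteq> U"
      using Wallace_theorem_prod_topology[OF NC(2)[OF E(1)] MD(2)[OF E(2)] C(2)] C(3) E(3) by blast
    obtain M N where "M \<in> \<N>" "E \<subseteq> M" "M \<subseteq> V" "N \<in> \<M>" "F \<subseteq> N" "N \<subseteq> W"
      using NC(4)[OF E(1) VW(1,3)] MD(4)[OF E(2) VW(2,4)] by blast
    then show "\<exists>N\<in>(\<lambda>(M, N). M \<times> N) ` (\<N> \<times> \<M>). C \<subseteq> N \<and> N \<subseteq> U"
      using E(3) VW(5) by (intro bexI[of _ "M \<times> N"]) auto
  qed (use NC(1) MD(1) in auto)
qed

text \<open>By induction: appending a coordinate maps the product of the \<open>n\<close>-th power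
  and \<open>X\<close> onto the next power.\<close>

lemma lindelof_sigma_power:
  fixes X :: "'a topology"
  assumes "lindelof_sigma_space X"
  shows "lindelof_sigma_space (product_topology (\<lambda>_. X) {..<n::nat})"
proof (induction n)
  case 0
  let ?T = "product_topology (\<lambda>_. X) {..<0::nat}"
  have fin: "finite (topspace ?T)" by simp
  show ?case
    by (rule lindelof_sigma_spaceI[of "{topspace ?T}" "{topspace ?T}"])
      (use finite_imp_compactin[OF _ fin] in auto)
next
  case (Suc n)
  let ?f = "\<lambda>(g, x :: 'a). \<lambda>i. if i = n then x else g i"
  let ?Z = "prod_topology (product_topology (\<lambda>_. X) {..<n}) X"
  let ?T = "product_topology (\<lambda>_. X) {..<Suc n}"
  have cont: "continuous_map ?Z ?T ?f"
    unfolding continuous_map_componentwise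
  proof (intro conjI ballI)
    show "?f ` topspace ?Z \<subseteq> extensional {..<Suc n}"
      by (auto simp: extensional_def PiE_iff)
    fix i assume i: "i \<in> {..<Suc n}"
    show "continuous_map ?Z X (\<lambda>z. ?f z i)"
    proof (cases "i = n")
      case True
      then show ?thesis using continuous_map_snd by (auto simp: case_prod_unfold)
    next
      case False
      then have "i \<in> {..<n}" using i by auto
      then have "continuous_map ?Z X ((\<lambda>g. g i) \<circ> fst)"
        by (intro continuous_map_compose[OF continuous_map_fst] continuous_map_product_projection)
      then show ?thesis using False by (auto simp: case_prod_unfold o_def)
    qed
  qed
  have "h \<in> ?f ` topspace ?Z" if h: "h \<in> topspace ?T" for h
  proof (rule image_eqI)
    show "h = ?f (restrict h {..<n}, h n)"
      using h by (fastforce simp: PiE_iff extensional_def)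
    show "(restrict h {..<n}, h n) \<in> topspace ?Z"
      using h by (auto simp: PiE_iff)
  qed
  then have "?f ` topspace ?Z = topspace ?T"
    using continuous_map_image_subset_topspace[OF cont] by blast
  then show ?case
    using lindelof_sigma_continuous_image[OF lindelof_sigma_prod[OF Suc assms] cont]
    by (metis subtopology_topspace)
qed

lemma dual_equiv_lindelof_sigma_space:
  fixes X :: "'a topology" and Y :: "'b topology"
  assumes Y: "tychonoff_space Y" and dual: "dual_equiv X Y \<phi> \<psi>" and X: "lindelof_sigma_space X"
  shows "lindelof_sigma_space Y"
proof -
  obtain P :: "nat \<Rightarrow> int list list \<Rightarrow> (nat \<Rightarrow> 'a) set" and p
  where P: "\<And>N c. closedin (product_topology (\<lambda>_. X) {..<N}) (P N c)"
    "\<And>N c. continuous_map (subtopology (product_topology (\<lambda>_. X) {..<N}) (P N c)) Y (p N c)"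
    "topspace Y = (\<Union>N c. p N c ` P N c)"
    by (rule dual_equiv_cover[OF Y dual]) (rule that)
  have "lindelof_sigma_space (subtopology Y (p N c ` P N c))" for N c
  proof -
    have "topspace (subtopology (product_topology (\<lambda>_. X) {..<N}) (P N c)) = P N c"
      using closedin_subset[OF P(1)] by (rule topspace_subtopology_subset)
    then show ?thesis
      using lindelof_sigma_continuous_image[OF lindelof_sigma_closed_subspace[OF lindelof_sigma_power[OF X] P(1)] P(2)]
      by metis
  qed
  then show ?thesis
    by (intro lindelof_sigma_countable_union[of UNIV Y "\<lambda>(N, c). p N c ` P N c"])
      (auto simp: P(3))
qed

text \<open>The boxes whose sides are members of \<C> are compact by Tychonoff's theorem, and
  countably many of them fill a finite power.\<close>

lemma sigma_compact_power:
  assumes "sigma_compact_space X"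
  shows "sigma_compact_space (product_topology (\<lambda>_. X) {..<n::nat})"
proof -
  obtain \<C> where "countable \<C> \<and> (\<forall>C\<in>\<C>. compactin X C) \<and> \<Union>\<C> = topspace X"
    using assms unfolding sigma_compact_space_def by (elim exE) (rule that)
  then have C: "countable \<C>" "\<And>C. C \<in> \<C> \<Longrightarrow> compactin X C" "\<Union>\<C> = topspace X"
    by simp_all
  show ?thesis
    unfolding sigma_compact_space_def
  proof (intro exI[of _ "Pi\<^sub>E {..<n} ` ({..<n} \<rightarrow>\<^sub>E \<C>)"] conjI ballI)
    show "countable (Pi\<^sub>E {..<n} ` ({..<n} \<rightarrow>\<^sub>E \<C>))"
      using C(1) by (intro countable_image countable_PiE) auto
    show "compactin (product_topology (\<lambda>_. X) {..<n}) D" if "D \<in> Pi\<^sub>E {..<n} ` ({..<n} \<rightarrow>\<^sub>E \<C>)" for D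
      using that C(2) by (auto simp: compactin_PiE PiE_iff)
    show "\<Union>(Pi\<^sub>E {..<n} ` ({..<n} \<rightarrow>\<^sub>E \<C>)) = topspace (product_topology (\<lambda>_. X) {..<n})"
    proof
      show "topspace (product_topology (\<lambda>_. X) {..<n}) \<subseteq> \<Union>(Pi\<^sub>E {..<n} ` ({..<n} \<rightarrow>\<^sub>E \<C>))"
      proof
        fix x assume "x \<in> topspace (product_topology (\<lambda>_. X) {..<n})"
        then have x: "x \<in> {..<n} \<rightarrow>\<^sub>E \<Union>\<C>" using C(3) by simp
        then have "\<forall>i\<in>{..<n}. \<exists>D\<in>\<C>. x i \<in> D" by (auto simp: PiE_iff)
        then obtain D where D: "\<And>i. i \<in> {..<n} \<Longrightarrow> D i \<in> \<C> \<and> x i \<in> D i" by metis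
        have "x \<in> Pi\<^sub>E {..<n} (restrict D {..<n})" "restrict D {..<n} \<in> {..<n} \<rightarrow>\<^sub>E \<C>"
          using x D by (auto simp: PiE_iff)
        then show "x \<in> \<Union>(Pi\<^sub>E {..<n} ` ({..<n} \<rightarrow>\<^sub>E \<C>))" by blast
      qed
      show "\<Union>(Pi\<^sub>E {..<n} ` ({..<n} \<rightarrow>\<^sub>E \<C>)) \<subseteq> topspace (product_topology (\<lambda>_. X) {..<n})"
        using C(3) by (fastforce simp: PiE_iff)
    qed
  qed
qed

lemma dual_equiv_sigma_compact_space:
  fixes X :: "'a topology" and Y :: "'b topology"
  assumes Y: "tychonoff_space Y" and dual: "dual_equiv X Y \<phi> \<psi>" and X: "sigma_compact_space X"
  shows "sigma_compact_space Y"
proof -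
  obtain P :: "nat \<Rightarrow> int list list \<Rightarrow> (nat \<Rightarrow> 'a) set" and p
  where P: "\<And>N c. closedin (product_topology (\<lambda>_. X) {..<N}) (P N c)"
    "\<And>N c. continuous_map (subtopology (product_topology (\<lambda>_. X) {..<N}) (P N c)) Y (p N c)"
    "topspace Y = (\<Union>N c. p N c ` P N c)"
    by (rule dual_equiv_cover[OF Y dual]) (rule that)
  have "\<forall>N. \<exists>\<C>. countable \<C> \<and> (\<forall>C\<in>\<C>. compactin (product_topology (\<lambda>_. X) {..<N}) C) \<and>
      \<Union>\<C> = topspace (product_topology (\<lambda>_. X) {..<N::nat})"
    using sigma_compact_power[OF X] unfolding sigma_compact_space_def by blast
  then obtain \<C> where C: "\<And>N. countable (\<C> N)"
    "\<And>N C. C \<in> \<C> N \<Longrightarrow> compactin (product_topology (\<lambda>_. X) {..<N}) C"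
    "\<And>N. \<Union>(\<C> N) = topspace (product_topology (\<lambda>_. X) {..<N::nat})"
    by metis
  define \<D> where "\<D> = (\<Union>(N, c)\<in>UNIV. (\<lambda>C. p N c ` (C \<inter> P N c)) ` \<C> N)"
  have "countable \<D>" unfolding \<D>_def using C(1) by auto
  moreover have "compactin Y D" if D: "D \<in> \<D>" for D
  proof -
    obtain N c C' where "C' \<in> \<C> N" "D = p N c ` (C' \<inter> P N c)" using D by (auto simp: \<D>_def)
    moreover have "compactin (product_topology (\<lambda>_. X) {..<N}) (C' \<inter> P N c)"
      by (intro compact_Int_closedin C(2) P(1) \<open>C' \<in> \<C> N\<close>)
    ultimately show ?thesis
      by (simp add: image_compactin[OF _ P(2)] compactin_subtopology)
  qed
  moreover have "\<Union>\<D> = topspace Y"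
  proof -
    have sub: "P N c \<subseteq> \<Union>(\<C> N)" for N c unfolding C(3) by (rule closedin_subset[OF P(1)])
    have img: "(\<Union>C\<in>\<C> N. p N c ` (C \<inter> P N c)) = p N c ` P N c" for N c
    proof -
      have "(\<Union>C\<in>\<C> N. p N c ` (C \<inter> P N c)) = p N c ` (\<Union>(\<C> N) \<inter> P N c)" by blast
      then show ?thesis by (simp only: Int_absorb1[OF sub])
    qed
    have "\<Union>\<D> = (\<Union>N c. \<Union>C\<in>\<C> N. p N c ` (C \<inter> P N c))"
      unfolding \<D>_def by auto
    then show ?thesis by (simp only: P(3) img)
  qed
  ultimately show ?thesis unfolding sigma_compact_space_def by (intro exI[of _ \<D>]) blast
qed

subsection \<open>Pseudocompactness\<close>

text \<open>If a limit point \<open>p\<close> of the image were missed, the reciprocal of the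
  distance to \<open>p\<close> would be a continuous unbounded function on \<open>X\<close>.\<close>

lemma pseudocompact_closed_image:
  fixes \<Phi> :: "'a \<Rightarrow> 'm::metric_space"
  assumes X: "pseudocompact X" and \<Phi>: "continuous_map X euclidean \<Phi>"
  shows "closed (\<Phi> ` topspace X)"
proof -
  have "p \<in> \<Phi> ` topspace X" if p: "p \<in> closure (\<Phi> ` topspace X)" for p
  proof (rule ccontr)
    assume np: "p \<notin> \<Phi> ` topspace X"
    have "continuous_map (top_of_set (- {p})) euclideanreal (\<lambda>z. inverse (dist z p))"
      by (auto intro!: continuous_intros)
    moreover have "continuous_map X (top_of_set (- {p})) \<Phi>"
      using \<Phi> np by (auto simp: continuous_map_in_subtopology)
    ultimately have "continuous_map X euclideanreal (\<lambda>x. inverse (dist (\<Phi> x) p))"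
      using continuous_map_compose[of X "top_of_set (- {p})" \<Phi> euclideanreal "\<lambda>z. inverse (dist z p)"]
      by (simp add: o_def)
    then have "bounded ((\<lambda>x. inverse (dist (\<Phi> x) p)) ` topspace X)"
      using X by (auto simp: pseudocompact_def)
    then obtain B where B: "B > 0" "\<And>x. x \<in> topspace X \<Longrightarrow> \<bar>inverse (dist (\<Phi> x) p)\<bar> \<le> B"
      unfolding bounded_pos by auto
    then obtain x where x: "x \<in> topspace X" "dist (\<Phi> x) p < inverse B"
      using p unfolding closure_approachable by (metis imageE positive_imp_inverse_positive)
    moreover have "dist (\<Phi> x) p > 0" using x np by force
    ultimately have "B < inverse (dist (\<Phi> x) p)"
      using B(1) less_imp_inverse_less inverse_inverse_eq by metis
    then show False using B(2)[OF x(1)] by simp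
  qed
  then show ?thesis by (metis closure_subset closure_eq subsetI subset_antisym)
qed

lemma continuous_map_into_sequences:
  fixes f :: "nat \<Rightarrow> 'a \<Rightarrow> 'b::topological_space"
  assumes "\<And>n. continuous_map X euclidean (f n)"
  shows "continuous_map X euclidean (\<lambda>x n. f n x)"
proof -
  have "continuous_map X (product_topology (\<lambda>_::nat. euclidean) UNIV) (\<lambda>x n. f n x)"
    using assms by (simp add: continuous_map_componentwise_UNIV)
  then show ?thesis by (simp only: euclidean_product_topology)
qed

lemma compact_sequence_box:
  fixes S :: "'b::topological_space set"
  assumes "compact S"
  shows "compact {v :: nat \<Rightarrow> 'b. \<forall>n. v n \<in> S}"
proof -
  have "compactin (product_topology (\<lambda>_::nat. euclidean) UNIV) (Pi\<^sub>E UNIV (\<lambda>_. S))"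
    using assms by (simp add: compactin_PiE)
  moreover have "Pi\<^sub>E UNIV (\<lambda>_. S) = {v :: nat \<Rightarrow> 'b. \<forall>n. v n \<in> S}" by auto
  ultimately show ?thesis by (simp add: euclidean_product_topology)
qed

text \<open>The limits are attained by eventual equality at each point: this is the mode of
  convergence that a product over finitely many points carries over exactly.\<close>

definition productive_family :: "'a topology \<Rightarrow> (nat \<Rightarrow> 'a \<Rightarrow> complex) \<Rightarrow> bool" where
  "productive_family X f \<longleftrightarrow>
     (\<forall>n. f n \<in> Cp_carrier X \<and> (\<exists>x\<in>topspace X. f n x \<noteq> 1)) \<and>
     (\<forall>z::nat \<Rightarrow> int. \<exists>F\<in>Cp_carrier X. \<forall>x\<in>topspace X.
        eventually (\<lambda>k. (\<Prod>n<k. f n x powi z n) = F x) sequentially)"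

lemma dual_equiv_one:
  assumes "dual_equiv X Y \<phi> \<psi>" "f \<in> Cp_carrier X" "\<And>x. x \<in> topspace X \<Longrightarrow> f x = 1" "y \<in> topspace Y"
  shows "\<phi> f y = 1"
proof -
  have "fin_char X (\<lambda>f. \<phi> f y)" using assms by (auto simp: dual_equiv_def)
  then obtain S k where "S \<subseteq> topspace X" "\<phi> f y = (\<Prod>x\<in>S. f x powi k x)"
    using assms(2) unfolding fin_char_def by blast
  then show ?thesis using assms(3) by (auto intro!: prod.neutral)
qed

text \<open>At a point \<open>y\<close> only the finitely many points of its support matter, and at
  these the partial products reach \<open>F\<close> simultaneously. Exchanging the two finite
  products gives the same statement for \<phi>.\<close>

lemma dual_equiv_productive_family:
  assumes dual: "dual_equiv X Y \<phi> \<psi>" and f: "productive_family X f"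
  shows "productive_family Y (\<lambda>n. \<phi> (f n))"
  unfolding productive_family_def
proof (intro conjI allI)
  have fC: "f n \<in> Cp_carrier X" for n using f by (auto simp: productive_family_def)
  show gC: "\<phi> (f n) \<in> Cp_carrier Y" for n using fC dual by (auto simp: dual_equiv_def)
  show "\<exists>y\<in>topspace Y. \<phi> (f n) y \<noteq> 1" for n
  proof (rule ccontr)
    assume "\<not> ?thesis"
    then have one: "\<And>y. y \<in> topspace Y \<Longrightarrow> \<phi> (f n) y = 1" by blast
    have "f n x = 1" if "x \<in> topspace X" for x
      using dual_equiv_one[OF dual_equiv_sym[OF dual] gC one that] fC dual
      by (simp add: dual_equiv_def)
    then show False using f unfolding productive_family_def by blast
  qed
  fix z :: "nat \<Rightarrow> int"
  obtain F where F: "F \<in> Cp_carrier X"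
    "\<And>x. x \<in> topspace X \<Longrightarrow> eventually (\<lambda>k. (\<Prod>n<k. f n x powi z n) = F x) sequentially"
    using f unfolding productive_family_def by blast
  have "eventually (\<lambda>k. (\<Prod>n<k. \<phi> (f n) y powi z n) = \<phi> F y) sequentially"
    if y: "y \<in> topspace Y" for y
  proof -
    have "fin_char X (\<lambda>f. \<phi> f y)" using dual y by (auto simp: dual_equiv_def)
    then obtain S c where S: "finite S" "S \<subseteq> topspace X"
      "\<And>f. f \<in> Cp_carrier X \<Longrightarrow> \<phi> f y = (\<Prod>x\<in>S. f x powi c x)"
      unfolding fin_char_def by blast
    have "eventually (\<lambda>k. \<forall>x\<in>S. (\<Prod>n<k. f n x powi z n) = F x) sequentially"
      using S(1,2) F(2) by (auto simp: eventually_ball_finite_distrib)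
    then show ?thesis
    proof eventually_elim
      case (elim k)
      have "(\<Prod>n<k. \<phi> (f n) y powi z n) = (\<Prod>n<k. \<Prod>x\<in>S. (f n x powi z n) powi c x)"
        by (simp add: S(3)[OF fC] prod_powi power_int_mult[symmetric] mult.commute)
      also have "\<dots> = (\<Prod>x\<in>S. (\<Prod>n<k. f n x powi z n) powi c x)"
        by (subst prod.swap) (simp add: prod_powi)
      also have "\<dots> = \<phi> F y" using elim by (simp add: S(3)[OF F(1)])
      finally show ?case .
    qed
  qed
  moreover have "\<phi> F \<in> Cp_carrier Y" using F(1) dual by (auto simp: dual_equiv_def)
  ultimately show "\<exists>F\<in>Cp_carrier Y. \<forall>y\<in>topspace Y.
      eventually (\<lambda>k. (\<Prod>n<k. \<phi> (f n) y powi z n) = F y) sequentially" by blast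
qed

text \<open>For unbounded \<open>g\<close> the angles \<open>v n \<bar>g x\<bar>\<close> climb from
  0 to 1 while |g| runs from n to n + 1. At each point only finitely many of them are nonzero, so
  they can be combined with arbitrary integer coefficients.\<close>

lemma productive_familyI:
  assumes "\<not> pseudocompact X"
  shows "\<exists>f. productive_family X f"
proof -
  obtain g where g: "continuous_map X euclideanreal g" "\<not> bounded (g ` topspace X)"
    using assms by (auto simp: pseudocompact_def)
  define v :: "nat \<Rightarrow> real \<Rightarrow> real" where "v n t = min 1 (max 0 (t - n))" for n t
  define f where "f n = cis_map X (\<lambda>x. v n \<bar>g x\<bar>)" for n
  have vcont: "continuous_on A (v n)" for n A
    unfolding v_def by (intro continuous_intros)
  have comp: "continuous_map X euclideanreal (\<lambda>x. s \<bar>g x\<bar>)" if "continuous_on UNIV s" for s :: "real \<Rightarrow> real"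
  proof -
    have "continuous_map euclideanreal euclideanreal s" using that by simp
    moreover have "continuous_map X euclideanreal (\<lambda>x. \<bar>g x\<bar>)" by (intro continuous_intros g)
    ultimately show ?thesis
      using continuous_map_compose[of X euclideanreal "\<lambda>x. \<bar>g x\<bar>" euclideanreal s] by (simp add: o_def)
  qed
  have "f n \<in> Cp_carrier X" for n
    unfolding f_def by (intro cis_map_in_Cp comp vcont)
  moreover have "\<exists>x\<in>topspace X. f n x \<noteq> 1" for n
  proof -
    obtain x where x: "x \<in> topspace X" "\<bar>g x\<bar> > n"
      using g(2) unfolding bounded_iff by (metis image_iff not_le real_norm_def)
    then have "0 < v n \<bar>g x\<bar>" "v n \<bar>g x\<bar> < pi" using pi_gt3 by (auto simp: v_def)
    then have "sin (v n \<bar>g x\<bar>) > 0" by (rule sin_gt_zero)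
    then have "f n x \<noteq> 1" using x by (auto simp: f_def complex_eq_iff)
    then show ?thesis using x by blast
  qed
  moreover have "\<exists>F\<in>Cp_carrier X. \<forall>x\<in>topspace X.
        eventually (\<lambda>k. (\<Prod>n<k. f n x powi z n) = F x) sequentially" for z :: "nat \<Rightarrow> int"
  proof -
    \<comment> \<open>The terms with \<open>n \<ge> t\<close> are zero, so the sum may be cut at any
      larger index. Near each \<open>t\<close> it agrees with one fixed finite sum, which gives
      continuity.\<close>
    define s where "s t = (\<Sum>n<nat \<lceil>t\<rceil>. z n * v n t)" for t
    have s: "s t = (\<Sum>n<k. z n * v n t)" if "t \<le> real k" for t k
      unfolding s_def
    proof (rule sum.mono_neutral_left)
      show "{..<nat \<lceil>t\<rceil>} \<subseteq> {..<k}" using that by (simp add: nat_ceiling_le_eq)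
      show "\<forall>i\<in>{..<k} - {..<nat \<lceil>t\<rceil>}. z i * v i t = 0"
        by (auto simp: v_def not_less nat_ceiling_le_eq)
    qed simp
    have "isCont s t" for t
    proof -
      obtain k :: nat where k: "t < k" using reals_Archimedean2 by blast
      have "continuous_on {..<real k} (\<lambda>t. \<Sum>n<k. z n * v n t)"
        by (intro continuous_intros vcont)
      then have "continuous_on {..<real k} s"
        by (rule continuous_on_eq) (auto intro!: s[symmetric])
      then show ?thesis using k by (simp add: continuous_on_eq_continuous_at)
    qed
    then have "cis_map X (\<lambda>x. s \<bar>g x\<bar>) \<in> Cp_carrier X"
      by (intro cis_map_in_Cp comp continuous_at_imp_continuous_on) auto
    moreover have "eventually (\<lambda>k. (\<Prod>n<k. f n x powi z n) = cis_map X (\<lambda>x. s \<bar>g x\<bar>) x) sequentially"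
      if x: "x \<in> topspace X" for x
    proof -
      have cis_sum: "(\<Prod>n<k. cis (a n)) = cis (\<Sum>n<k. a n)" for k :: nat and a
        by (induction k) (auto simp: cis_mult)
      obtain N :: nat where N: "\<bar>g x\<bar> \<le> N" using real_arch_simple by blast
      have "(\<Prod>n<k. f n x powi z n) = cis_map X (\<lambda>x. s \<bar>g x\<bar>) x" if "k \<ge> N" for k
      proof -
        have "(\<Prod>n<k. f n x powi z n) = (\<Prod>n<k. cis (z n * v n \<bar>g x\<bar>))"
          using x by (simp add: f_def cis_power_int)
        then show ?thesis using x N that by (simp add: cis_sum s[of _ k])
      qed
      then show ?thesis unfolding eventually_sequentially by blast
    qed
    ultimately show ?thesis by blast
  qed
  ultimately have "productive_family X f" unfolding productive_family_def by blast
  then show ?thesis by blast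
qed

text \<open>If \<open>b\<close> is not already far from 1, a power of \<open>a\<close> at distance
  at least 1 from 1 pushes the product away by the triangle inequality.\<close>

lemma circle_escape:
  fixes a b :: complex
  assumes "norm a = 1" "a \<noteq> 1" "norm b = 1"
  shows "\<exists>n::int. norm (b * a powi n - 1) \<ge> 1 / 2"
proof (cases "norm (b - 1) \<ge> 1 / 2")
  case True
  then show ?thesis by (intro exI[of _ 0]) simp
next
  case False
  obtain n :: nat where n: "norm (a ^ n - 1) \<ge> 1"
    using circle_no_small_subgroup assms by blast
  have "norm (a ^ n - 1) = norm (b * (a ^ n - 1))" by (simp add: norm_mult assms)
  also have "b * (a ^ n - 1) = (b * a ^ n - 1) - (b - 1)" by (simp add: algebra_simps)
  also have "norm \<dots> \<le> norm (b * a ^ n - 1) + norm (b - 1)" by (rule norm_triangle_ineq4)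
  finally have "norm (b * a ^ n - 1) \<ge> 1 / 2" using n False by linarith
  then show ?thesis by (intro exI[of _ "int n"]) simp
qed

text \<open>The exponents are chosen recursively so that the product \<open>F\<close> stays away from \<open>1\<close>
  along a sequence whose values under all \<open>f n\<close> converge to those of a point where \<open>F = 1\<close>;
  pseudocompactness realises the limit of the values of all \<open>f n\<close> and of \<open>F\<close> at one point.\<close>
lemma pseudocompact_no_productive_family:
  assumes X: "pseudocompact X" and f: "productive_family X f"
  shows False
proof -
  have fC: "f n \<in> Cp_carrier X" for n using f by (auto simp: productive_family_def)
  have prodF: "\<exists>F\<in>Cp_carrier X. \<forall>x\<in>topspace X.
      eventually (\<lambda>k. (\<Prod>n<k. f n x powi z n) = F x) sequentially" for z :: "nat \<Rightarrow> int"
    using f unfolding productive_family_def by blast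
  obtain x where x: "\<And>n. x n \<in> topspace X" "\<And>n. f n (x n) \<noteq> 1"
    using f unfolding productive_family_def by metis
  \<comment> \<open>With all exponents 1, consecutive partial products at \<open>y\<close> are
    eventually equal, which forces the factors to be 1.\<close>
  have fin: "\<exists>N. \<forall>n\<ge>N. f n y = 1" if y: "y \<in> topspace X" for y
  proof -
    obtain F where F: "F \<in> Cp_carrier X"
      "\<And>x. x \<in> topspace X \<Longrightarrow> eventually (\<lambda>k. (\<Prod>n<k. f n x powi 1) = F x) sequentially"
      using prodF[of "\<lambda>_. 1"] by blast
    then obtain N where N: "\<And>k. k \<ge> N \<Longrightarrow> (\<Prod>n<k. f n y) = F y"
      using y F(2)[OF y] by (auto simp: eventually_sequentially)
    have "f n y = 1" if "n \<ge> N" for n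
    proof -
      have "F y * f n y = F y" using N[of n] N[of "Suc n"] that by simp
      then show ?thesis using Cp_carrier_nonzero[OF F(1) y] by simp
    qed
    then show ?thesis by blast
  qed
  then obtain d where d: "\<And>y n. y \<in> topspace X \<Longrightarrow> n \<ge> d y \<Longrightarrow> f n y = 1" by metis
  define \<Phi> where "\<Phi> y = (\<lambda>n. f n y)" for y
  have \<Phi>cont: "continuous_map X euclidean \<Phi>"
    unfolding \<Phi>_def by (rule continuous_map_into_sequences) (use fC in \<open>simp add: Cp_carrier_iff\<close>)
  have "seq_compact {v :: nat \<Rightarrow> complex. \<forall>n. v n \<in> sphere 0 1}"
    by (rule compact_imp_seq_compact[OF compact_sequence_box]) simp
  moreover have "\<Phi> (x n) \<in> {v. \<forall>n. v n \<in> sphere 0 1}" for n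
    using Cp_carrier_norm[OF fC x(1)] by (simp add: \<Phi>_def)
  ultimately obtain p r where r: "strict_mono r" "(\<lambda>n. \<Phi> (x (r n))) \<longlonglongrightarrow> p"
    unfolding seq_compact_def o_def by meson
  have "p \<in> \<Phi> ` topspace X"
    by (rule closed_sequentially[OF pseudocompact_closed_image[OF X \<Phi>cont] _ r(2)]) (use x(1) in auto)
  then obtain x0 where x0: "x0 \<in> topspace X" "p = \<Phi> x0" by blast
  define t where "t = rec_nat (d x0) (\<lambda>_ j. Suc (j + d (x (r j))))"
  have t0: "t 0 = d x0" and tSuc: "t (Suc k) = Suc (t k + d (x (r (t k))))" for k
    by (auto simp: t_def)
  have tmono: "strict_mono t" by (rule strict_mono_Suc_iff[THEN iffD2]) (simp add: tSuc)
  define s where "s = r \<circ> t"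
  have smono: "strict_mono s" unfolding s_def by (rule strict_mono_o[OF r(1) tmono])
  have sge: "s k \<ge> t k" for k unfolding s_def using strict_mono_imp_increasing[OF r(1)] by simp
  have s0: "s k \<ge> d x0" for k
    using sge[of k] strict_mono_mono[OF tmono] t0 by (metis le0 le_trans monoD)
  have sd: "d (x (s k)) \<le> s (Suc k)" for k
    using sge[of "Suc k"] by (simp add: tSuc s_def)
  \<comment> \<open>The exponent at step \<open>k\<close> has to keep the product at
    \<open>x (s k)\<close> at distance at least 1/2 from 1. The condition looks at \<open>w\<close>
    only below \<open>k\<close>, so the exponents can be chosen recursively.\<close>
  define Q where "Q w k n \<longleftrightarrow>
      norm ((\<Prod>i<k. f (s i) (x (s k)) powi w i) * f (s k) (x (s k)) powi n - 1) \<ge> 1 / 2"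
    for w :: "nat \<Rightarrow> int" and k n
  have "\<exists>w. \<forall>k. Q w k (w k)"
  proof (rule dependent_wellorder_choice)
    fix n :: int and w w' :: "nat \<Rightarrow> int" and k :: nat
    assume "\<And>i. i < k \<Longrightarrow> w i = w' i"
    then show "Q w k n = Q w' k n" by (simp add: Q_def)
  next
    fix k :: nat and w :: "nat \<Rightarrow> int"
    show "\<exists>n. Q w k n"
      unfolding Q_def
      by (rule circle_escape)
        (use x Cp_carrier_norm[OF fC x(1)] in \<open>auto simp: norm_power_int prod_norm[symmetric]\<close>)
  qed
  then obtain w where w: "\<And>k. Q w k (w k)" by blast
  \<comment> \<open>Maps outside the chosen subsequence get exponent 0 and drop out of all
    products.\<close>
  define z where "z m = (if m \<in> range s then w (inv s m) else 0)" for m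
  have zs: "z (s i) = w i" for i
    using strict_mono_imp_inj_on[OF smono] by (simp add: z_def)
  obtain F where F: "F \<in> Cp_carrier X"
    "\<And>y. y \<in> topspace X \<Longrightarrow> eventually (\<lambda>k. (\<Prod>n<k. f n y powi z n) = F y) sequentially"
    using prodF[of z] by blast
  \<comment> \<open>All chosen indices are at least \<open>d x0\<close>, so the chosen maps are 1 at
    \<open>x0\<close>, and hence at every point with the same values under all
    \<open>f n\<close>.\<close>
  have F1: "F y = 1" if y: "y \<in> topspace X" "\<Phi> y = p" for y
  proof -
    have "f n y powi z n = 1" for n
    proof (cases "n \<in> range s")
      case True
      then have "f n x0 = 1" using d[OF x0(1)] s0 by blast
      then show ?thesis using y(2) x0(2) by (auto simp: \<Phi>_def dest: fun_cong[of _ _ n])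
    qed (simp add: z_def)
    then show ?thesis using F(2)[OF y(1)] by auto
  qed
  \<comment> \<open>At \<open>x (s k)\<close> the chosen maps after the \<open>k\<close>-th are 1,
    so \<open>F\<close> equals there the very product that \<open>Q\<close> controls.\<close>
  have F2: "norm (F (x (s k)) - 1) \<ge> 1 / 2" for k
  proof -
    obtain K where K: "\<And>K'. K' \<ge> K \<Longrightarrow> (\<Prod>n<K'. f n (x (s k)) powi z n) = F (x (s k))"
      using F(2)[OF x(1)] unfolding eventually_sequentially by blast
    define M where "M = max K (Suc (s k))"
    have sub: "s ` {..k} \<subseteq> {..<M}"
      by (auto simp: M_def less_max_iff_disj less_Suc_eq_le strict_mono_less_eq[OF smono])
    have "F (x (s k)) = (\<Prod>n<M. f n (x (s k)) powi z n)" using K[of M] by (simp add: M_def)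
    also have "\<dots> = (\<Prod>n\<in>s ` {..k}. f n (x (s k)) powi z n)"
    proof (rule prod.mono_neutral_right[OF _ sub])
      show "\<forall>n\<in>{..<M} - s ` {..k}. f n (x (s k)) powi z n = 1"
      proof
        fix n assume n: "n \<in> {..<M} - s ` {..k}"
        show "f n (x (s k)) powi z n = 1"
        proof (cases "n \<in> range s")
          case True
          then obtain i where i: "n = s i" by blast
          then have "Suc k \<le> i" using n by (metis DiffD2 atMost_iff image_eqI not_less_eq_eq)
          then have "s (Suc k) \<le> n" using i strict_mono_less_eq[OF smono] by blast
          then have "f n (x (s k)) = 1" using d[OF x(1)] sd[of k] le_trans by blast
          then show ?thesis by simp
        qed (simp add: z_def)
      qed
    qed simp
    also have "\<dots> = (\<Prod>i\<le>k. f (s i) (x (s k)) powi w i)"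
      using strict_mono_imp_inj_on[OF smono] zs
      by (subst prod.reindex) (auto intro: inj_on_subset)
    also have "\<dots> = (\<Prod>i<k. f (s i) (x (s k)) powi w i) * f (s k) (x (s k)) powi w k"
      by (simp add: lessThan_Suc_atMost[symmetric])
    finally show ?thesis using w[of k] by (simp add: Q_def)
  qed
  have "seq_compact (sphere 0 1 :: complex set)" by (rule compact_imp_seq_compact) simp
  moreover have "F (x (s k)) \<in> sphere 0 1" for k
    using Cp_carrier_norm[OF F(1) x(1)] by simp
  ultimately obtain q u where u: "strict_mono u" "(\<lambda>k. F (x (s (u k)))) \<longlonglongrightarrow> q"
    unfolding seq_compact_def o_def by meson
  have "strict_mono (t \<circ> u)" by (rule strict_mono_o[OF tmono u(1)])
  then have "(\<lambda>k. \<Phi> (x (s (u k)))) \<longlonglongrightarrow> p"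
    using LIMSEQ_subseq_LIMSEQ[OF r(2)] by (fastforce simp: s_def o_def)
  then have lim: "(\<lambda>k. (\<Phi> (x (s (u k))), F (x (s (u k))))) \<longlonglongrightarrow> (p, q)"
    using u(2) by (rule tendsto_Pair)
  \<comment> \<open>The joint map has a closed image, so \<open>(p, q)\<close> is attained at a
    single point. There \<open>F\<close> is 1, although \<open>q\<close> is at distance at least 1/2
    from 1.\<close>
  have "continuous_map X euclidean (\<lambda>y. (\<Phi> y, F y))"
    using \<Phi>cont F(1) continuous_map_paired[of X euclidean euclidean \<Phi> F] by (simp add: Cp_carrier_iff)
  then have "(p, q) \<in> (\<lambda>y. (\<Phi> y, F y)) ` topspace X"
    by (rule closed_sequentially[OF pseudocompact_closed_image[OF X] _ lim]) (use x(1) in auto)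
  then have "q = 1" using F1 by auto
  moreover have "1 / 2 \<le> norm (q - 1)"
    using u(2) F2 by (intro tendsto_lowerbound[where F = sequentially and f = "\<lambda>k. norm (F (x (s (u k))) - 1)"] tendsto_intros) auto
  ultimately show False by simp
qed

lemma dual_equiv_pseudocompact:
  assumes "dual_equiv X Y \<phi> \<psi>" "pseudocompact X"
  shows "pseudocompact Y"
proof (rule ccontr)
  assume "\<not> pseudocompact Y"
  then obtain f where "productive_family Y f" using productive_familyI by blast
  then have "productive_family X (\<lambda>n. \<psi> (f n))"
    by (rule dual_equiv_productive_family[OF dual_equiv_sym[OF assms(1)]])
  then show False using pseudocompact_no_productive_family[OF assms(2)] by blast
qed

subsection \<open>Compactness and metrizability\<close>

text \<open>For each compact piece \<open>K n\<close> choose a finite subfamily covering it and a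
  function that is 0 on \<open>K n\<close> and 1 off the subfamily. Together these functions map Y
  onto a closed, hence compact, subset of the cube; finitely many of the sets where the
  \<open>n\<close>-th coordinate is below 1 cover it, and the corresponding subfamilies cover
  Y.\<close>

lemma sigma_compact_pseudocompact_imp_compact_space:
  assumes Y: "completely_regular_space Y" and sig: "sigma_compact_space Y" and ps: "pseudocompact Y"
  shows "compact_space Y"
proof -
  obtain \<C> where C0: "countable \<C> \<and> (\<forall>C\<in>\<C>. compactin Y C) \<and> \<Union>\<C> = topspace Y"
    using sig unfolding sigma_compact_space_def by (elim exE) (rule that)
  show ?thesis
  proof (cases "\<C> = {}")
    case True
    then have "topspace Y = {}" using C0 by simp
    then show ?thesis by (simp add: compact_space_def)
  next
    case False
    define K where "K = from_nat_into \<C>"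
    have range_K: "range K = \<C>"
      unfolding K_def using False C0 by (simp add: range_from_nat_into)
    then have K: "compactin Y (K n)" for n using C0 by blast
    have "\<exists>\<F>. finite \<F> \<and> \<F> \<subseteq> \<U> \<and> topspace Y \<subseteq> \<Union>\<F>"
      if U: "\<And>U. U \<in> \<U> \<Longrightarrow> openin Y U" "topspace Y \<subseteq> \<Union>\<U>" for \<U>
    proof -
      have "\<exists>\<F>. finite \<F> \<and> \<F> \<subseteq> \<U> \<and> K n \<subseteq> \<Union>\<F>" for n
        using compactinD[OF K] U compactin_subset_topspace[OF K] by (meson order_trans)
      then obtain \<F> where F: "\<And>n. finite (\<F> n)" "\<And>n. \<F> n \<subseteq> \<U>" "\<And>n. K n \<subseteq> \<Union>(\<F> n)"
        by metis
      have "\<exists>h. continuous_map Y (top_of_set {0..1::real}) h \<and> h ` K n \<subseteq> {0} \<and>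
          h ` (topspace Y - \<Union>(\<F> n)) \<subseteq> {1}" for n
      proof -
        have "closedin Y (topspace Y - \<Union>(\<F> n))"
          using U(1) F(2)[of n] by (intro closedin_diff closedin_topspace openin_Union) auto
        moreover have "disjnt (topspace Y - \<Union>(\<F> n)) (K n)" using F(3)[of n] by (auto simp: disjnt_def)
        ultimately show ?thesis
          using Urysohn_completely_regular_closed_compact[of 0 1 Y "topspace Y - \<Union>(\<F> n)" "K n"] K Y
          by (metis zero_le_one)
      qed
      then obtain h where h: "\<And>n. continuous_map Y (top_of_set {0..1::real}) (h n)"
        "\<And>n. h n ` K n \<subseteq> {0}" "\<And>n. h n ` (topspace Y - \<Union>(\<F> n)) \<subseteq> {1}"
        by metis
      define \<Phi> where "\<Phi> y = (\<lambda>n. h n y)" for y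
      have "continuous_map Y euclidean \<Phi>"
        unfolding \<Phi>_def
        by (rule continuous_map_into_sequences) (use h(1) in \<open>auto simp: continuous_map_in_subtopology\<close>)
      then have "closed (\<Phi> ` topspace Y)" by (rule pseudocompact_closed_image[OF ps])
      moreover have "\<Phi> ` topspace Y \<subseteq> {v. \<forall>n. v n \<in> {0..1}}"
      proof -
        have "h n y \<in> {0..1}" if "y \<in> topspace Y" for n y
          using h(1)[of n] that by (auto simp: continuous_map_in_subtopology Pi_iff)
        then show ?thesis by (auto simp: \<Phi>_def)
      qed
      ultimately have "compact (\<Phi> ` topspace Y)"
        using compact_Int_closed[OF compact_sequence_box[OF compact_Icc], of "\<Phi> ` topspace Y" 0 1]
        by (simp add: Int_absorb1)
      moreover have "open {v :: nat \<Rightarrow> real. v n < 1}" for n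
        by (rule open_Collect_less[OF continuous_on_product_coordinates continuous_on_const])
      moreover have "\<Phi> ` topspace Y \<subseteq> (\<Union>n\<in>UNIV. {v. v n < 1})"
      proof clarify
        fix y assume "y \<in> topspace Y"
        then obtain n where "y \<in> K n" using C0 range_K by blast
        then have "h n y = 0" using h(2)[of n] by blast
        then show "\<Phi> y \<in> (\<Union>n\<in>UNIV. {v. v n < 1})" by (auto simp: \<Phi>_def intro!: exI[of _ n])
      qed
      ultimately obtain N where N: "finite N" "\<Phi> ` topspace Y \<subseteq> (\<Union>n\<in>N. {v. v n < 1})"
        by (rule compactE_image) blast
      have "topspace Y \<subseteq> \<Union>(\<Union>n\<in>N. \<F> n)"
      proof
        fix y assume y: "y \<in> topspace Y"
        then obtain n where n: "n \<in> N" "h n y < 1" using N(2) by (auto simp: \<Phi>_def)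
        have "y \<in> \<Union>(\<F> n)"
        proof (rule ccontr)
          assume "y \<notin> \<Union>(\<F> n)"
          then have "h n y = 1" using h(3)[of n] y by blast
          then show False using n by simp
        qed
        then show "y \<in> \<Union>(\<Union>n\<in>N. \<F> n)" using n(1) by blast
      qed
      then show ?thesis using N(1) F(1,2) by (intro exI[of _ "\<Union>n\<in>N. \<F> n"]) auto
    qed
    then show ?thesis unfolding compact_space_alt by blast
  qed
qed

lemma compact_imp_pseudocompact: "compact_space X \<Longrightarrow> pseudocompact X"
  unfolding pseudocompact_def compact_space_def
  by (metis compact_imp_bounded compactin_euclidean_iff image_compactin)

lemma compact_imp_sigma_compact_space: "compact_space X \<Longrightarrow> sigma_compact_space X"
  unfolding sigma_compact_space_def compact_space_def
  by (intro exI[of _ "{topspace X}"]) auto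

lemma dual_equiv_compact_space:
  fixes X :: "'a topology" and Y :: "'b topology"
  assumes Y: "tychonoff_space Y" and dual: "dual_equiv X Y \<phi> \<psi>" and X: "compact_space X"
  shows "compact_space Y"
proof (rule sigma_compact_pseudocompact_imp_compact_space)
  show "completely_regular_space Y" using Y by (simp add: tychonoff_space_def)
  show "sigma_compact_space Y"
    by (rule dual_equiv_sigma_compact_space[OF Y dual compact_imp_sigma_compact_space[OF X]])
  show "pseudocompact Y"
    by (rule dual_equiv_pseudocompact[OF dual compact_imp_pseudocompact[OF X]])
qed

text \<open>The quotient of the evaluations at \<open>y\<close> and \<open>y'\<close> is a
  nontrivial character on X, so some exponent is nonzero. To separate \<open>y\<close> from
  \<open>y'\<close> by some \<open>\<phi> f\<close> it then suffices to find \<open>f\<close> whose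
  product over \<open>S\<close> differs from 1.\<close>

lemma dual_equiv_separation:
  assumes Y: "tychonoff_space Y" and dual: "dual_equiv X Y \<phi> \<psi>"
    and y: "y \<in> topspace Y" "y' \<in> topspace Y" "y \<noteq> y'"
  obtains S k x where "finite S" "S \<subseteq> topspace X" "x \<in> S" "k x \<noteq> (0::int)"
    "\<And>f. f \<in> Cp_carrier X \<Longrightarrow> \<phi> f y = \<phi> f y' \<Longrightarrow> (\<Prod>x\<in>S. f x powi k x) = 1"
proof -
  have "fin_char X (\<lambda>f. \<phi> f y * \<phi> f y' powi - 1)"
    by (intro fin_char_mult fin_char_powi) (use dual y in \<open>auto simp: dual_equiv_def\<close>)
  then obtain S k where S: "finite S" "S \<subseteq> topspace X"
    "\<And>f. f \<in> Cp_carrier X \<Longrightarrow> \<phi> f y * \<phi> f y' powi - 1 = (\<Prod>x\<in>S. f x powi k x)"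
    unfolding fin_char_def by blast
  obtain g where g: "g \<in> Cp_carrier Y" "g y \<noteq> g y'" using Cp_separates_points[OF Y y] by blast
  have f: "\<psi> g \<in> Cp_carrier X" "\<phi> (\<psi> g) = g" using dual g(1) by (auto simp: dual_equiv_def)
  have "(\<Prod>x\<in>S. \<psi> g x powi k x) \<noteq> 1"
    using S(3)[OF f(1)] g f(2) Cp_carrier_nonzero[OF g(1) y(2)]
    by (simp add: power_int_minus field_simps)
  then obtain x where x: "x \<in> S" "\<psi> g x powi k x \<noteq> 1"
    using prod.neutral[of S "\<lambda>x. \<psi> g x powi k x"] by blast
  then have "k x \<noteq> 0" by auto
  show thesis
  proof (rule that[where S = S and k = k and x = x, OF S(1,2) x(1) \<open>k x \<noteq> 0\<close>])
    fix f assume f: "f \<in> Cp_carrier X" "\<phi> f y = \<phi> f y'"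
    have "\<phi> f \<in> Cp_carrier Y" using dual f(1) by (auto simp: dual_equiv_def)
    then show "(\<Prod>x\<in>S. f x powi k x) = 1"
      using S(3)[OF f(1)] f(2) Cp_carrier_nonzero[of "\<phi> f" Y y'] y(2)
      by (simp add: power_int_minus)
  qed
qed

section \<open>Metrizability of compact spaces\<close>

lemma (in Metric_space) continuous_map_distance:
  assumes "a \<in> M"
  shows "continuous_map mtopology euclideanreal (d a)"
proof -
  have "continuous_map mtopology Met_TC.mtopology (d a)"
    unfolding Met_TC.continuous_map_to_metric
  proof (intro ballI allI impI)
    fix x and e :: real assume x: "x \<in> topspace mtopology" and e: "e > 0"
    have "d a y \<in> Met_TC.mball (d a x) e" if y: "y \<in> mball x e" for y
    proof -
      have "y \<in> M" "d x y < e" using y by (auto simp: in_mball)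
      then show ?thesis
        using triangle[of a x y] triangle[of a y x] x assms by (auto simp: dist_real_def commute)
    qed
    then show "\<exists>U. openin mtopology U \<and> x \<in> U \<and> (\<forall>y\<in>U. d a y \<in> Met_TC.mball (d a x) e)"
      using x e by (intro exI[of _ "mball x e"]) auto
  qed
  then show ?thesis by simp
qed

text \<open>Countably many separating maps give a continuous injection into the metrizable space of
  complex sequences, and on a compact space such a map is an embedding.\<close>

lemma compact_space_countable_separation_imp_metrizable:
  fixes G :: "nat \<Rightarrow> 'b \<Rightarrow> complex"
  assumes Y: "compact_space Y" and G: "\<And>m. continuous_map Y euclidean (G m)"
    and sep: "\<And>y y'. y \<in> topspace Y \<Longrightarrow> y' \<in> topspace Y \<Longrightarrow> y \<noteq> y' \<Longrightarrow> \<exists>m. G m y \<noteq> G m y'"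
  shows "metrizable_space Y"
proof -
  have "continuous_map Y euclidean (\<lambda>y m. G m y)"
    by (rule continuous_map_into_sequences[OF G])
  moreover have "inj_on (\<lambda>y m. G m y) (topspace Y)"
    using sep by (intro inj_onI) (metis)
  ultimately have "embedding_map Y euclidean (\<lambda>y m. G m y)"
    by (intro continuous_imp_embedding_map Y) auto
  then show ?thesis
    using embedding_map_imp_homeomorphic_space homeomorphic_metrizable_space
      metrizable_space_euclidean metrizable_space_subtopology by blast
qed

text \<open>A countable family of exponentials of tent functions, centred at a countable dense
  subset of X, is rich enough for its images under \<phi> to separate the points of Y.\<close>

lemma dual_equiv_compact_metrizable:
  assumes Y: "tychonoff_space Y" and dual: "dual_equiv X Y \<phi> \<psi>"
    and X: "compact_space X" "metrizable_space X" and cY: "compact_space Y"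
  shows "metrizable_space Y"
proof -
  obtain M d where "Metric_space M d" and XM: "X = Metric_space.mtopology M d"
    using X(2) unfolding metrizable_space_def by blast
  then interpret Metric_space M d by simp
  have tX: "topspace X = M" by (simp add: XM)
  have "mtotally_bounded M"
    using X(1) compact_space_eq_mcomplete_mtotally_bounded by (simp add: XM)
  then have "\<exists>K. finite K \<and> K \<subseteq> M \<and> M \<subseteq> (\<Union>x\<in>K. mball x (1 / Suc n))" for n
    unfolding mtotally_bounded_def by simp
  then obtain K where K: "\<And>n. finite (K n)" "\<And>n. K n \<subseteq> M" "\<And>n. M \<subseteq> (\<Union>x\<in>K n. mball x (1 / Suc n))"
    by metis
  define A where "A = (\<Union>n. K n)"
  have A: "countable A" "A \<subseteq> M" using K(1,2) by (auto simp: A_def countable_finite)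
  have dense: "\<exists>a\<in>A. d a x < e" if x: "x \<in> M" and e: "e > 0" for x e
  proof -
    obtain n where "1 / Suc n < e" using nat_approx_posE[OF e] by blast
    moreover obtain a where "a \<in> K n" "d a x < 1 / Suc n" using K(3)[of n] x by auto
    ultimately show ?thesis unfolding A_def by (intro bexI[of _ a]) auto
  qed
  \<comment> \<open>A tent of height 1 centred at \<open>a\<close> that vanishes where
    \<open>real q * d a x \<ge> 1\<close>. In \<open>f\<close> the division by \<open>Suc n\<close>
    keeps the angle small after an exponent is applied.\<close>
  define h where "h a q x = max 0 (1 - real q * d a x)" for a q x
  define f where "f a q n = cis_map X (\<lambda>x. h a q x / real (Suc n))" for a and q n :: nat
  have f: "f a q n \<in> Cp_carrier X" if "a \<in> A" for a q n
    unfolding f_def h_def divide_inverse XM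
    by (intro cis_map_in_Cp continuous_intros continuous_map_distance) (use that A(2) in auto)
  have sep: "\<exists>a\<in>A. \<exists>q n. \<phi> (f a q n) y \<noteq> \<phi> (f a q n) y'"
    if y: "y \<in> topspace Y" "y' \<in> topspace Y" "y \<noteq> y'" for y y'
  proof -
    obtain S k x where S: "finite S" "S \<subseteq> topspace X" "x \<in> S" "k x \<noteq> (0::int)"
      "\<And>f. f \<in> Cp_carrier X \<Longrightarrow> \<phi> f y = \<phi> f y' \<Longrightarrow> (\<Prod>x\<in>S. f x powi k x) = 1"
      by (rule dual_equiv_separation[OF Y dual y]) (rule that)
    have SM: "S \<subseteq> M" using S(2) tX by simp
    have "\<exists>e>0. \<forall>x'\<in>S - {x}. e \<le> d x x'"
    proof (cases "S - {x} = {}")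
      case False
      have "0 < d x x'" if "x' \<in> S - {x}" for x'
        using mdist_pos_less[of x x'] that S(3) SM by blast
      then show ?thesis
        using S(1) False by (intro exI[of _ "Min (d x ` (S - {x}))"]) auto
    qed (auto intro!: exI[of _ 1])
    then obtain e where e: "e > 0" "\<And>x'. x' \<in> S - {x} \<Longrightarrow> e \<le> d x x'" by blast
    \<comment> \<open>With \<open>e\<close> a lower bound for the distance from \<open>x\<close> to
      the rest of \<open>S\<close>, this slope and a centre within \<open>1 / (2 * real q)\<close>
      of \<open>x\<close> give a tent that is positive at \<open>x\<close> and 0 at the other points
      of \<open>S\<close>.\<close>
    obtain q :: nat where q: "2 / e < q" using reals_Archimedean2 by blast
    then have "0 < real q" using e(1) by (meson divide_pos_pos less_trans zero_less_numeral)
    then obtain a where a: "a \<in> A" "d a x < 1 / (2 * real q)"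
      using dense[of x "1 / (2 * real q)"] S(3) SM by auto
    have qa: "real q * d a x < 1 / 2" using a(2) \<open>0 < real q\<close> by (simp add: field_simps)
    have h0: "h a q x' = 0" if x': "x' \<in> S - {x}" for x'
    proof -
      have "d x x' \<le> d a x + d a x'"
        using triangle[of x a x'] commute[of x a] x' S(3) SM A(2) a(1) by auto
      then have "e \<le> d a x + d a x'" using e(2)[OF x'] by linarith
      then have "real q * e \<le> real q * d a x + real q * d a x'"
        using \<open>0 < real q\<close> by (metis distrib_left mult_le_cancel_left_pos)
      moreover have "2 < real q * e" using q e(1) by (simp add: field_simps)
      ultimately show ?thesis using qa by (simp add: h_def)
    qed
    have h1: "0 < h a q x" "h a q x \<le> 1"
      using qa \<open>0 < real q\<close> by (auto simp: h_def)
    \<comment> \<open>This divisor puts the angle \<alpha> strictly between -1 and 1, and it is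
      nonzero, so \<open>cis \<alpha>\<close> cannot be 1.\<close>
    define n where "n = nat \<bar>k x\<bar>"
    define \<alpha> where "\<alpha> = k x * (h a q x / real (Suc n))"
    have "\<alpha> \<noteq> 0" using S(4) h1 by (simp add: \<alpha>_def)
    moreover have "\<bar>\<alpha>\<bar> < 1"
    proof -
      have "\<bar>\<alpha>\<bar> = \<bar>real_of_int (k x)\<bar> * h a q x / real (Suc n)"
        using h1 by (simp add: \<alpha>_def abs_mult)
      also have "\<dots> \<le> \<bar>real_of_int (k x)\<bar> / real (Suc n)"
        using h1 by (intro divide_right_mono mult_left_le) auto
      also have "\<dots> < 1" by (simp add: n_def)
      finally show ?thesis .
    qed
    ultimately have "sin \<alpha> \<noteq> 0"
      using sin_gt_zero[of \<alpha>] sin_gt_zero[of "- \<alpha>"] pi_gt3 by (cases "\<alpha> > 0") auto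
    then have "cis \<alpha> \<noteq> 1" by (auto simp: complex_eq_iff)
    moreover have "(\<Prod>z\<in>S. f a q n z powi k z) = cis \<alpha>"
    proof -
      have "(\<Prod>z\<in>S. f a q n z powi k z) = (\<Prod>z\<in>S. if z = x then cis \<alpha> else 1)"
        by (intro prod.cong refl)
          (use S(2) h0 in \<open>auto simp: f_def cis_power_int \<alpha>_def\<close>)
      then show ?thesis using S(1,3) by simp
    qed
    ultimately have "\<phi> (f a q n) y \<noteq> \<phi> (f a q n) y'" using S(5)[OF f[OF a(1)]] by metis
    then show ?thesis using a(1) by blast
  qed
  \<comment> \<open>The constant map makes \<open>D\<close> nonempty even if X is empty, so that
    \<open>from_nat_into\<close> enumerates it.\<close>
  define D where "D = insert (cis_map X (\<lambda>_. 0)) ((\<lambda>(a, q, n). f a q n) ` (A \<times> UNIV \<times> UNIV))"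
  have D: "countable D" "D \<noteq> {}" "D \<subseteq> Cp_carrier X"
    using A(1) f by (auto simp: D_def intro!: cis_map_in_Cp)
  have range: "range (from_nat_into D) = D" using D by (simp add: range_from_nat_into)
  show ?thesis
  proof (rule compact_space_countable_separation_imp_metrizable[OF cY])
    fix m
    have "from_nat_into D m \<in> Cp_carrier X" using range D(3) by blast
    then have "\<phi> (from_nat_into D m) \<in> Cp_carrier Y" using dual by (auto simp: dual_equiv_def)
    then show "continuous_map Y euclidean (\<phi> (from_nat_into D m))" by (simp add: Cp_carrier_iff)
  next
    fix y y' assume "y \<in> topspace Y" "y' \<in> topspace Y" "y \<noteq> y'"
    then obtain a q n where a: "a \<in> A" "\<phi> (f a q n) y \<noteq> \<phi> (f a q n) y'" using sep by blast
    then have "f a q n \<in> D"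
      unfolding D_def by (intro insertI2 image_eqI[of _ _ "(a, q, n)"]) auto
    then have "f a q n \<in> range (from_nat_into D)" by (simp only: range)
    then show "\<exists>m. \<phi> (from_nat_into D m) y \<noteq> \<phi> (from_nat_into D m) y'" using a(2) by auto
  qed
qed

subsection \<open>Connectedness\<close>

definition clopens :: "'a topology \<Rightarrow> 'a set set" where
  "clopens X = {U. openin X U \<and> closedin X U}"

text \<open>If there are finitely many components, they are open and the clopen sets are exactly
  their unions. Conversely, finitely many clopen sets leave only finitely many quasi-components,
  which then coincide with the components.\<close>

lemma finite_components_iff_clopens:
  "finite (connected_components_of X) \<and> card (connected_components_of X) = n \<longleftrightarrow>
     finite (clopens X) \<and> card (clopens X) = 2 ^ n"
proof -
  have bij: "bij_betw Union (Pow (connected_components_of X)) (clopens X)"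
    if fin: "finite (connected_components_of X)"
  proof (rule bij_betwI')
    fix A B assume AB: "A \<in> Pow (connected_components_of X)" "B \<in> Pow (connected_components_of X)"
    have sub: "A \<subseteq> B"
      if eq: "\<Union>A = \<Union>B" and A: "A \<subseteq> connected_components_of X"
        and B: "B \<subseteq> connected_components_of X" for A B
    proof
      fix C assume C: "C \<in> A"
      then obtain c where c: "c \<in> C" using A nonempty_connected_components_of by blast
      then obtain C' where C': "C' \<in> B" "c \<in> C'" using eq C by blast
      then have "C = C'"
        using connected_components_of_overlap[of C X C'] A B C c by blast
      then show "C \<in> B" using C' by simp
    qed
    show "(\<Union>A = \<Union>B) = (A = B)" using sub[of A B] sub[of B A] AB by auto
  next
    fix A assume A: "A \<in> Pow (connected_components_of X)"
    then have "finite A" using fin finite_subset by blast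
    then have "closedin X (\<Union>A)"
      using A closedin_connected_components_of by (intro closedin_Union) auto
    moreover have "openin X (\<Union>A)"
      using A open_in_finite_connected_components[OF fin] by (intro openin_Union) auto
    ultimately show "\<Union>A \<in> clopens X" by (simp add: clopens_def)
  next
    fix U assume U: "U \<in> clopens X"
    have "U = \<Union>{C \<in> connected_components_of X. C \<subseteq> U}"
    proof
      show "U \<subseteq> \<Union>{C \<in> connected_components_of X. C \<subseteq> U}"
      proof
        fix x assume x: "x \<in> U"
        then have "x \<in> topspace X" using U openin_subset by (auto simp: clopens_def)
        then obtain C where C: "C \<in> connected_components_of X" "x \<in> C"
          using Union_connected_components_of[of X] by blast
        have "C \<subseteq> U \<or> disjnt C U"
          using connectedin_clopen_cases[OF connectedin_connected_components_of[OF C(1)]] U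
          by (auto simp: clopens_def)
        then have "C \<subseteq> U" using C(2) x by (auto simp: disjnt_def)
        then show "x \<in> \<Union>{C \<in> connected_components_of X. C \<subseteq> U}" using C by blast
      qed
    qed auto
    then show "\<exists>A\<in>Pow (connected_components_of X). U = \<Union>A"
      by (intro bexI[of _ "{C \<in> connected_components_of X. C \<subseteq> U}"]) auto
  qed
  have fin: "finite (connected_components_of X)" if clop: "finite (clopens X)"
  proof -
    \<comment> \<open>A quasi-component is the intersection of the clopen sets that contain one of
      its points.\<close>
    have "quasi_components_of X \<subseteq> Inter ` Pow (clopens X)"
      by (auto simp: quasi_components_of_def quasi_component_of_set clopens_def intro!: imageI)
    then have "finite (quasi_components_of X)"
      by (rule finite_subset) (use clop in simp)
    then show ?thesis using quasi_eq_connected_components_of by metis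
  qed
  have card: "card (clopens X) = 2 ^ card (connected_components_of X)"
    if "finite (connected_components_of X)"
    using bij_betw_same_card[OF bij[OF that]] that by (simp add: card_Pow)
  have "finite (clopens X)" if "finite (connected_components_of X)"
    using bij_betw_finite[OF bij[OF that]] that by simp
  then show ?thesis using fin card by (auto simp: power_inject_exp)
qed

definition sign_maps :: "'a topology \<Rightarrow> ('a \<Rightarrow> complex) set" where
  "sign_maps X = {f \<in> Cp_carrier X. \<forall>x\<in>topspace X. (f x)\<^sup>2 = 1}"

lemma continuous_map_clopen_if:
  assumes "U \<in> clopens X"
  shows "continuous_map X euclideanreal (\<lambda>x. if x \<in> U then a else b)"
  unfolding continuous_map_def
proof (intro conjI allI impI)
  fix V :: "real set"
  have UX: "U \<subseteq> topspace X" "openin X U" "openin X (topspace X - U)"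
    using assms by (auto simp: clopens_def closedin_def)
  have "{x \<in> topspace X. (if x \<in> U then a else b) \<in> V} =
      (if a \<in> V then U else {}) \<union> (if b \<in> V then topspace X - U else {})"
    using UX(1) by auto
  then show "openin X {x \<in> topspace X. (if x \<in> U then a else b) \<in> V}"
    using UX(2,3) by auto
qed auto

text \<open>The complement of the fibre is the preimage of the remaining finitely many values, which
  form a closed set.\<close>

lemma finite_valued_clopen:
  fixes g :: "'a \<Rightarrow> complex"
  assumes g: "continuous_map X euclidean g" and fin: "finite R" "g ` topspace X \<subseteq> R"
  shows "{x \<in> topspace X. g x = c} \<in> clopens X"
proof -
  have "closedin X {x \<in> topspace X. g x \<in> {c}}"
    using g by (rule closedin_continuous_map_preimage) auto
  moreover have "closedin X {x \<in> topspace X. g x \<in> R - {c}}"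
    using g by (rule closedin_continuous_map_preimage) (use fin(1) in \<open>simp add: finite_imp_closed\<close>)
  moreover have "{x \<in> topspace X. g x = c} = topspace X - {x \<in> topspace X. g x \<in> R - {c}}"
    using fin(2) by auto
  ultimately show ?thesis by (auto simp: clopens_def closedin_def)
qed

text \<open>A map whose square is 1 takes only the values 1 and -1, so it is determined by the
  clopen set on which it is 1. This expresses the number of clopen sets through the elements of
  order at most 2 of the group.\<close>

lemma bij_betw_sign_maps_clopens: "bij_betw (\<lambda>f. {x \<in> topspace X. f x = 1}) (sign_maps X) (clopens X)"
proof (rule bij_betwI')
  fix f g assume f: "f \<in> sign_maps X" and g: "g \<in> sign_maps X"
  have val: "f x = 1 \<or> f x = -1" "g x = 1 \<or> g x = -1" if "x \<in> topspace X" for x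
    using f g that by (auto simp: sign_maps_def power2_eq_1_iff)
  show "({x \<in> topspace X. f x = 1} = {x \<in> topspace X. g x = 1}) = (f = g)"
  proof
    assume eq: "{x \<in> topspace X. f x = 1} = {x \<in> topspace X. g x = 1}"
    show "f = g"
    proof (rule Cp_carrier_eqI)
      fix x assume x: "x \<in> topspace X"
      then have "f x = 1 \<longleftrightarrow> g x = 1" using eq by blast
      then show "f x = g x" using val[OF x] by auto
    qed (use f g in \<open>auto simp: sign_maps_def\<close>)
  qed simp
next
  fix f assume f: "f \<in> sign_maps X"
  show "{x \<in> topspace X. f x = 1} \<in> clopens X"
    by (rule finite_valued_clopen[of _ _ "{1, -1}"])
      (use f in \<open>auto simp: sign_maps_def Cp_carrier_iff power2_eq_1_iff\<close>)
next
  fix U assume U: "U \<in> clopens X"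
  define f where "f = cis_map X (\<lambda>x. if x \<in> U then 0 else pi)"
  have "f \<in> sign_maps X"
    using cis_map_in_Cp[OF continuous_map_clopen_if[OF U]] by (auto simp: sign_maps_def f_def)
  moreover have "U = {x \<in> topspace X. f x = 1}"
  proof -
    have "U \<subseteq> topspace X" using U openin_subset by (auto simp: clopens_def)
    then show ?thesis by (auto simp: f_def split: if_splits)
  qed
  ultimately show "\<exists>f\<in>sign_maps X. U = {x \<in> topspace X. f x = 1}" by blast
qed

text \<open>Integer exponents commute with the \<open>n\<close>-th power. The case
  \<open>n = 2\<close> transfers sign maps; larger \<open>n\<close> bound the set of values in the
  transfer of total disconnectedness.\<close>

lemma fin_char_root_of_unity:
  assumes "fin_char X \<xi>" "f \<in> Cp_carrier X" "\<And>x. x \<in> topspace X \<Longrightarrow> f x ^ n = 1"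
  shows "\<xi> f ^ n = 1"
proof -
  obtain S k where S: "S \<subseteq> topspace X" "\<xi> f = (\<Prod>x\<in>S. f x powi k x)"
    using assms(1,2) unfolding fin_char_def by blast
  have "\<xi> f ^ n = (\<Prod>x\<in>S. (f x powi k x) ^ n)" by (simp add: S(2) prod_power_distrib)
  also have "\<dots> = (\<Prod>x\<in>S. (f x ^ n) powi k x)"
    by (simp add: mult.commute flip: power_int_mult power_int_of_nat)
  also have "\<dots> = 1" using S(1) assms(3) by (intro prod.neutral) auto
  finally show ?thesis .
qed

lemma dual_equiv_bij_betw_sign_maps:
  assumes "dual_equiv X Y \<phi> \<psi>"
  shows "bij_betw \<phi> (sign_maps X) (sign_maps Y)"
proof -
  show ?thesis
  proof (rule bij_betw_byWitness[where f' = \<psi>])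
    show "\<phi> ` sign_maps X \<subseteq> sign_maps Y"
      using assms fin_char_root_of_unity[where n = 2] by (fastforce simp: sign_maps_def dual_equiv_def)
    show "\<psi> ` sign_maps Y \<subseteq> sign_maps X"
      using assms fin_char_root_of_unity[where n = 2] by (fastforce simp: sign_maps_def dual_equiv_def)
  qed (use assms in \<open>auto simp: sign_maps_def dual_equiv_def\<close>)
qed

lemma dual_equiv_components:
  assumes "dual_equiv X Y \<phi> \<psi>"
  shows "finite (connected_components_of X) \<and> card (connected_components_of X) = n \<longleftrightarrow>
     finite (connected_components_of Y) \<and> card (connected_components_of Y) = n"
proof -
  have "finite (clopens X) = finite (clopens Y)" "card (clopens X) = card (clopens Y)"
    using bij_betw_finite[OF bij_betw_sign_maps_clopens[of X]] bij_betw_finite[OF bij_betw_sign_maps_clopens[of Y]]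
      bij_betw_same_card[OF bij_betw_sign_maps_clopens[of X]] bij_betw_same_card[OF bij_betw_sign_maps_clopens[of Y]]
      bij_betw_finite[OF dual_equiv_bij_betw_sign_maps[OF assms]]
      bij_betw_same_card[OF dual_equiv_bij_betw_sign_maps[OF assms]] by simp_all
  then show ?thesis by (simp only: finite_components_iff_clopens)
qed

text \<open>The case of no components is the empty space, which counts as connected.\<close>

lemma connected_space_iff_card_components:
  "connected_space X \<longleftrightarrow>
     (finite (connected_components_of X) \<and> card (connected_components_of X) = 0) \<or>
     (finite (connected_components_of X) \<and> card (connected_components_of X) = 1)"
proof
  assume "connected_space X"
  then have "\<exists>S. connected_components_of X \<subseteq> {S}"
    by (simp add: connected_space_iff_components_subset_singleton)
  then show "(finite (connected_components_of X) \<and> card (connected_components_of X) = 0) \<or>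
     (finite (connected_components_of X) \<and> card (connected_components_of X) = 1)"
    by (auto simp: subset_singleton_iff)
next
  assume "(finite (connected_components_of X) \<and> card (connected_components_of X) = 0) \<or>
     (finite (connected_components_of X) \<and> card (connected_components_of X) = 1)"
  then have "\<exists>S. connected_components_of X \<subseteq> {S}"
    by (auto simp: card_1_singleton_iff)
  then show "connected_space X"
    by (simp add: connected_space_iff_components_subset_singleton)
qed

lemma dual_equiv_connected_space:
  assumes "dual_equiv X Y \<phi> \<psi>"
  shows "connected_space X \<longleftrightarrow> connected_space Y"
  using dual_equiv_components[OF assms, of 0] dual_equiv_components[OF assms, of 1]
  by (simp only: connected_space_iff_card_components)

section \<open>Total disconnectedness\<close>

lemma totally_disconnected_finite_separation:
  assumes X: "totally_disconnected_space X" and F: "finite F" "F \<subseteq> topspace X"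
    and x: "x \<in> topspace X" "x \<notin> F"
  shows "\<exists>U\<in>clopens X. x \<in> U \<and> U \<inter> F = {}"
  using F x(2)
proof (induction F rule: finite_induct)
  case empty
  show ?case using x(1) by (intro bexI[of _ "topspace X"]) (auto simp: clopens_def)
next
  case (insert y F)
  then obtain U where U: "U \<in> clopens X" "x \<in> U" "U \<inter> F = {}" by auto
  have "y \<in> topspace X" "x \<noteq> y" using insert.prems by auto
  then obtain V where "openin X V" "closedin X V" and V: "x \<in> V" "y \<notin> V"
    using X x(1) unfolding totally_disconnected_space_def by blast
  show ?case
    using U V \<open>openin X V\<close> \<open>closedin X V\<close> by (intro bexI[of _ "U \<inter> V"]) (auto simp: clopens_def)
qed

text \<open>A locally constant map on X whose values are roots of unity has an image under \<phi>
  with values among the same roots of unity. The fibres of that image are clopen, and one of them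
  separates the two points of Y.\<close>

lemma dual_equiv_totally_disconnected_space:
  assumes Y: "tychonoff_space Y" and dual: "dual_equiv X Y \<phi> \<psi>" and X: "totally_disconnected_space X"
  shows "totally_disconnected_space Y"
  unfolding totally_disconnected_space_def
proof (intro ballI impI)
  fix y y' assume y: "y \<in> topspace Y" "y' \<in> topspace Y" "y \<noteq> y'"
  obtain S k x where S: "finite S" "S \<subseteq> topspace X" "x \<in> S" "k x \<noteq> (0::int)"
    "\<And>f. f \<in> Cp_carrier X \<Longrightarrow> \<phi> f y = \<phi> f y' \<Longrightarrow> (\<Prod>x\<in>S. f x powi k x) = 1"
    by (rule dual_equiv_separation[OF Y dual y]) (rule that)
  obtain U where U: "U \<in> clopens X" "x \<in> U" "U \<inter> (S - {x}) = {}"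
    using totally_disconnected_finite_separation[OF X, of "S - {x}" x] S by blast
  \<comment> \<open>\<open>U\<close> meets \<open>S\<close> only in \<open>x\<close>, and the angle
    is chosen so that the power with exponent \<open>k x\<close> is -1, which makes the whole
    product -1.\<close>
  define f where "f = cis_map X (\<lambda>z. if z \<in> U then pi / k x else 0)"
  have f: "f \<in> Cp_carrier X"
    unfolding f_def by (rule cis_map_in_Cp[OF continuous_map_clopen_if[OF U(1)]])
  have "(\<Prod>z\<in>S. f z powi k z) = (\<Prod>z\<in>S. if z = x then -1 else 1)"
  proof (intro prod.cong refl)
    fix z assume z: "z \<in> S"
    then have "z \<in> topspace X" "z \<in> U \<longleftrightarrow> z = x" using S(2) U(2,3) by auto
    then show "f z powi k z = (if z = x then -1 else 1)"
      using S(4) by (simp add: f_def cis_power_int)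
  qed
  then have "(\<Prod>z\<in>S. f z powi k z) = -1" using S(1,3) by simp
  then have ne: "\<phi> f y \<noteq> \<phi> f y'" using S(5)[OF f] by auto
  \<comment> \<open>Twice the absolute value of \<open>k x\<close> turns the angle
    \<open>pi / k x\<close> into a full turn, in one direction or the other.\<close>
  define N where "N = 2 * nat \<bar>k x\<bar>"
  have N: "N > 0" using S(4) by (simp add: N_def)
  have "cis (pi / k x) ^ N = 1"
  proof -
    have "real N * (pi / k x) = 2 * pi \<or> real N * (pi / k x) = - (2 * pi)"
      using S(4) by (auto simp: N_def abs_if field_simps)
    then show ?thesis by (auto simp: Complex.DeMoivre complex_eq_iff)
  qed
  then have fN: "f z ^ N = 1" if "z \<in> topspace X" for z
    using that by (simp add: f_def)
  have "\<phi> f v ^ N = 1" if "v \<in> topspace Y" for v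
    by (rule fin_char_root_of_unity[OF _ f fN]) (use dual that in \<open>auto simp: dual_equiv_def\<close>)
  then have "\<phi> f ` topspace Y \<subseteq> {w. w ^ N = 1}" by auto
  moreover have "finite {w :: complex. w ^ N = 1}" using N by (intro finite_roots_unity) simp
  moreover have "continuous_map Y euclidean (\<phi> f)"
    using dual f by (auto simp: dual_equiv_def Cp_carrier_iff)
  ultimately have "{v \<in> topspace Y. \<phi> f v = \<phi> f y} \<in> clopens Y"
    by (intro finite_valued_clopen)
  then show "\<exists>V. openin Y V \<and> closedin Y V \<and> y \<in> V \<and> y' \<notin> V"
    using ne y by (intro exI[of _ "{v \<in> topspace Y. \<phi> f v = \<phi> f y}"]) (auto simp: clopens_def)
qed

text \<open>Equality of the numbers l* is stated as having the same infinite upper bounds, with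
  cardinals represented by infinite sets \<open>K\<close>. Each equivalence comes from one-way
  transfers applied to \<open>XY\<close> and \<open>YX\<close>, or from an equivalence obtained
  directly from \<open>XY\<close>.\<close>

theorem theorem10p7:
  fixes X :: "'a topology" and Y :: "'b topology"
  assumes "tychonoff_space X" and "tychonoff_space Y"
    and "Cp_top_isomorphic X Y"
  shows "(pseudocompact X \<longleftrightarrow> pseudocompact Y)
    \<and> (\<forall>K :: 'c set. infinite K \<longrightarrow> (lstar_le X K \<longleftrightarrow> lstar_le Y K))
    \<and> (lindelof_sigma_space X \<longleftrightarrow> lindelof_sigma_space Y)
    \<and> (sigma_compact_space X \<longleftrightarrow> sigma_compact_space Y)
    \<and> (compact_space X \<longleftrightarrow> compact_space Y)
    \<and> (compact_space X \<and> metrizable_space X \<longleftrightarrow> compact_space Y \<and> metrizable_space Y)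
    \<and> (\<forall>n::nat. n > 0 \<longrightarrow>
         ((finite (connected_components_of X) \<and> card (connected_components_of X) = n) \<longleftrightarrow>
          (finite (connected_components_of Y) \<and> card (connected_components_of Y) = n)))
    \<and> (connected_space X \<longleftrightarrow> connected_space Y)
    \<and> (totally_disconnected_space X \<longleftrightarrow> totally_disconnected_space Y)"
proof -
  obtain \<phi> \<psi> where XY: "dual_equiv X Y \<phi> \<psi>"
    by (rule Cp_top_isomorphic_dual_equiv[OF assms]) (rule that)
  note YX = dual_equiv_sym[OF XY]
  note X = assms(1) and Y = assms(2)
  have cpt: "compact_space X \<longleftrightarrow> compact_space Y"
    using dual_equiv_compact_space[OF Y XY] dual_equiv_compact_space[OF X YX] by blast
  show ?thesis
  proof (intro conjI allI impI)
    show "pseudocompact X \<longleftrightarrow> pseudocompact Y"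
      using dual_equiv_pseudocompact[OF XY] dual_equiv_pseudocompact[OF YX] by blast
    show "lstar_le X K \<longleftrightarrow> lstar_le Y K" if "infinite K" for K :: "'c set"
      using dual_equiv_lstar_le[OF Y XY that] dual_equiv_lstar_le[OF X YX that] by blast
    show "lindelof_sigma_space X \<longleftrightarrow> lindelof_sigma_space Y"
      using dual_equiv_lindelof_sigma_space[OF Y XY] dual_equiv_lindelof_sigma_space[OF X YX] by blast
    show "sigma_compact_space X \<longleftrightarrow> sigma_compact_space Y"
      using dual_equiv_sigma_compact_space[OF Y XY] dual_equiv_sigma_compact_space[OF X YX] by blast
    show "compact_space X \<longleftrightarrow> compact_space Y" by (rule cpt)
    show "compact_space X \<and> metrizable_space X \<longleftrightarrow> compact_space Y \<and> metrizable_space Y"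
      using cpt dual_equiv_compact_metrizable[OF Y XY] dual_equiv_compact_metrizable[OF X YX] by blast
    show "finite (connected_components_of X) \<and> card (connected_components_of X) = n \<longleftrightarrow>
        finite (connected_components_of Y) \<and> card (connected_components_of Y) = n" for n
      by (rule dual_equiv_components[OF XY])
    show "connected_space X \<longleftrightarrow> connected_space Y" by (rule dual_equiv_connected_space[OF XY])
    show "totally_disconnected_space X \<longleftrightarrow> totally_disconnected_space Y"
      using dual_equiv_totally_disconnected_space[OF Y XY] dual_equiv_totally_disconnected_space[OF X YX]
      by blast
  qed
qed

end
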